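(* Let $\alpha\in\mathbb{C}$ and let $\mathcal{E}\subset\mathbb{C}P^2$ be the singular cubic given in an affine chart by $\eta^2=(\zeta-\alpha)^3$. Then: (i) The addition of points on $\mathcal{E}$ and the involution $\sigma:(\zeta,\eta)\mapsto(\zeta,-\eta)$, $\infty\mapsto\infty$, define on $\mathbb{C}P^1$ the unique structure, independent of $\alpha$ up to coset-isomorphism, of a two-valued coset algebraic monoid $\mathbb{M}_2(\mathbb{C}P^1)$. (ii) The three-valued group $\mathbb{G}_{3,c}(\mathbb{C}P^1)$, with multiplication defined by $p_{3,c}(z;-x,-y)$, becomes in the limit $c\to0$ the monoid $\mathbb{M}_3(\mathbb{C}P^1)$. (iii) The four-valued group $\mathbb{G}_{4,b}(\mathbb{C}P^1)$, with multiplication defined by $p_{4,b}(z;x,y)$, becomes in the limit $b\to0$ the monoid $\mathbb{M}_4(\mathbb{C}P^1)$. (iv) The six-valued group $\mathbb{G}_{6,c}(\mathbb{C}P^1)$, with multiplication defined by $p_{6,c}(z;x,y)$, becomes in the limit $c\to0$ the monoid $\mathbb{M}_6(\mathbb{C}P^1)$. Here "becomes in the limit" means that the multiplication defined by the coefficientwise limit (the specialization at parameter $0$) of the defining polynomial is that of the indicated monoid.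
   Context: $\mathbb{C}P^1=\mathbb{C}\cup\{\infty\}$, $x=x_1/x_0$ for $(x_1:x_0)$, $\infty=(1:0)$. $\mathrm{Sym}^n(X)$ is the set of $n$-element multisets of elements of $X$. An algebraic $n$-valued monoid is an algebraic variety $X$ with a rational (possibly only partially defined) morphism $\ast:X\times X\to\mathrm{Sym}^n(X)$ which is associative (the multisets $[x\ast w\mid w\in y\ast z]$ and $[w\ast z\mid w\in x\ast y]$ coincide) and has a neutral element $e$ with $x\ast e=e\ast x=[x,\dots,x]$ for every $x$. The operation on $\mathbb{C}P^1$ defined by a polynomial $P(z;x,y)$ of degree at most $n$ in each variable: $(x_1:x_0)\ast(y_1:y_0)$ is the multiset of the $n$ zeros (with multiplicity) in $(z_1:z_0)$ of the form $(x_0y_0z_0)^nP(z_1/z_0;x_1/x_0,y_1/y_0)$; undefined where this form vanishes identically. For $n\ge1$ and $\varepsilon=e^{2\pi i/n}$ let $p_n(z;x,y)=\prod_{r,s=1}^n(\sqrt[n]{z}+\varepsilon^r\sqrt[n]{x}+\varepsilon^s\sqrt[n]{y})$, a symmetric polynomial in $x,y,z$ with integer coefficients. $\mathbb{M}_n(\mathbb{C}P^1)$ is the algebraic $n$-valued monoid on $\mathbb{C}P^1$ with neutral element $0$ and operation defined by $p_n(z;(-1)^nx,(-1)^ny)$ (undefined only at $(\infty,\infty)$). The cubic is parametrized by the slope $m=\eta/(\zeta-\alpha)\in\mathbb{C}P^1$ of the line through the cusp; the addition of points (neutral element $\infty$) is the partially defined operation $m_1\oplus m_2=m_1m_2/(m_1+m_2)$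 (undefined only for $m_1=m_2=0$), and $\sigma$ is $m\mapsto-m$. Coset construction: for a (1-valued, possibly partially defined) monoid $M$ and $H\subset\mathrm{Aut}(M)$ of order $n$, with projection $\pi:M\to M/H$, the coset $n$-valued monoid $M_H$ is $M/H$ with $\pi(u)\ast\pi(v)=[\pi(u\cdot h(v))\mid h\in H]$. Coset monoids $M_A$, $N_B$ are coset-isomorphic if there exist isomorphisms $\widetilde\varphi:M\to N$ and $\varphi:M/A\to N/B$ compatible with the projections, with the maps $(m_1,m_2)\mapsto[m_1\cdot a(m_2)\mid a\in A]$ (and likewise for $N,B$), and with the $n$-valued multiplications. $\mathbb{M}_2(\mathbb{C}P^1)$ is the coset monoid of $\mathbb{C}P^1$ with the operation $(z_1:z_0)\cdot(w_1:w_0)=(z_1w_0+z_0w_1:z_0w_0)$ (addition) and the involution $z\mapsto-z$, with orbit coordinate $z^2$. Polynomials ($\sigma_k$ = elementary symmetric functions of $x,y,z$; $b,c\neq0$ for the groups): $$p_{3,c}=\sigma_1^3-27\sigma_3+18c\sigma_1^2\sigma_3-54c\sigma_2\sigma_3-27c^2\sigma_2^2\sigma_3+81c^2\sigma_1\sigma_3^2;$$ $$\begin{aligned}p_{4,b}&=\sigma_1^4-8\sigma_1^2\sigma_2+16\sigma_2^2-128\sigma_1\sigma_3-112b\sigma_1^2\sigma_3-4b^2\sigma_1^3\sigma_3-64b\sigma_2\sigma_3-112b^2\sigma_1\sigma_2\sigma_3-64b^2\sigma_3^2\\&\quad-288b^3\sigma_1\sigma_3^2+6b^4\sigma_1^2\sigma_3^2-136b^4\sigma_2\sigma_3^2-112b^5\sigma_3^3-4b^6\sigma_1\sigma_3^3+b^8\sigma_3^4;\end{aligned}$$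 $$\begin{aligned} p_{6,c}&=\sigma_1^6-2^2\cdot3\,\sigma_1^4\sigma_2+2^4\cdot3\,\sigma_1^2\sigma_2^2-2^6\sigma_2^3-2\cdot3^4\cdot17\,\sigma_1^3\sigma_3-2^3\cdot3^4\cdot19\,\sigma_1\sigma_2\sigma_3+3^3\cdot19^3\sigma_3^2\\ &-2^5\cdot3^2\cdot11\,c\,\sigma_1^4\sigma_3-2^2\cdot3^3\cdot5\,c^2\sigma_1^5\sigma_3-2^4\cdot3^2\cdot211\,c\,\sigma_1^2\sigma_2\sigma_3\\ &-2^2\cdot3^3\cdot197\,c^2\sigma_1^3\sigma_2\sigma_3-2^3\cdot3^5c^3\sigma_1^4\sigma_2\sigma_3-2^6\cdot3^2\cdot5^2c\,\sigma_2^2\sigma_3\\ &-2^4\cdot3^3\cdot107\,c^2\sigma_1\sigma_2^2\sigma_3-2^4\cdot3^7c^3\sigma_1^2\sigma_2^2\sigma_3-2\cdot3^6c^4\sigma_1^3\sigma_2^2\sigma_3\\ &-2^6\cdot3^5c^3\sigma_2^3\sigma_3-2^3\cdot3^7c^4\sigma_1\sigma_2^3\sigma_3+2^4\cdot3^3\cdot7^2\cdot19\,c\,\sigma_1\sigma_3^2\\ &+2^2\cdot3^3\cdot47\cdot53\,c^2\sigma_1^2\sigma_3^2+2^3\cdot3^5\cdot61\,c^3\sigma_1^3\sigma_3^2+2\cdot3^7\cdot17\,c^4\sigma_1^4\sigma_3^2\\ &+2^2\cdot3^4\cdot701\,c^2\sigma_2\sigma_3^2+2^3\cdot3^6\cdot7\cdot13\,c^3\sigma_1\sigma_2\sigma_3^2+2^{10}\cdot3^6c^4\sigma_1^2\sigma_2\sigma_3^2\\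 &+2^4\cdot3^8\cdot5\,c^5\sigma_1^3\sigma_2\sigma_3^2+2\cdot3^7\cdot5\cdot17\,c^4\sigma_2^2\sigma_3^2+2^5\cdot3^8\cdot7\,c^5\sigma_1\sigma_2^2\sigma_3^2\\ &+2^2\cdot3^9\cdot17\,c^6\sigma_1^2\sigma_2^2\sigma_3^2+2^2\cdot3^9\cdot11\,c^6\sigma_2^3\sigma_3^2+2^3\cdot3^{11}c^7\sigma_1\sigma_2^3\sigma_3^2+3^{12}c^8\sigma_2^4\sigma_3^2\\ &-2^3\cdot3^{12}c^3\sigma_3^3-2\cdot3^9\cdot5\cdot47\,c^4\sigma_1\sigma_3^3-2^4\cdot3^9\cdot17\,c^5\sigma_1^2\sigma_3^3-2^2\cdot3^9\cdot5\,c^6\sigma_1^3\sigma_3^3\\ &-2^6\cdot3^{11}c^5\sigma_2\sigma_3^3-2^2\cdot3^{10}\cdot5\cdot11\,c^6\sigma_1\sigma_2\sigma_3^3-2^3\cdot3^{11}c^7\sigma_1^2\sigma_2\sigma_3^3-2^3\cdot3^{11}\cdot5\,c^7\sigma_2^2\sigma_3^3\\ &-2\cdot3^{12}c^8\sigma_1\sigma_2^2\sigma_3^3-2^3\cdot3^{12}c^6\sigma_3^4-2^3\cdot3^{12}c^7\sigma_1\sigma_3^4+3^{12}c^8\sigma_1^2\sigma_3^4-2^2\cdot3^{13}c^8\sigma_2\sigma_3^4. \end{aligned}$$ *)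

theory Defs
  imports
    "HOL-Analysis.Analysis"
    "HOL-Computational_Algebra.Computational_Algebra"
    "HOL-Library.Multiset"
begin

section \<open>The projective line and binary forms\<close>

datatype cp1 = Fin complex | Inf

text \<open>Homogeneous coordinates \<open>(x1 : x0)\<close>, with \<open>x = x1 / x0\<close> and \<open>\<infinity> = (1 : 0)\<close>.\<close>

fun num :: "cp1 \<Rightarrow> complex" where
  "num (Fin a) = a" | "num Inf = 1"

fun den :: "cp1 \<Rightarrow> complex" where
  "den (Fin a) = 1" | "den Inf = 0"

text \<open>The point \<open>(x1 : x0)\<close>; meaningful only for \<open>(x1, x0) \<noteq> (0, 0)\<close>.\<close>

definition ratio :: "complex \<Rightarrow> complex \<Rightarrow> cp1" where
  "ratio x1 x0 = (if x0 = 0 then Inf else Fin (x1 / x0))"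

text \<open>The binary form \<open>x0^d p(x1/x0)\<close> of degree \<open>d \<ge> degree p\<close>, at the coordinates of \<open>x\<close>.\<close>

definition bform :: "nat \<Rightarrow> complex poly \<Rightarrow> cp1 \<Rightarrow> complex" where
  "bform d p x = (\<Sum>i\<le>d. coeff p i * num x ^ i * den x ^ (d - i))"

text \<open>The zeros on the projective line, with multiplicity, of the form \<open>z0^n p(z1/z0)\<close>,
  for \<open>p \<noteq> 0\<close> with \<open>degree p \<le> n\<close>: the point \<open>\<infinity>\<close> is a zero of order \<open>n - degree p\<close>.\<close>

definition form_zeros :: "nat \<Rightarrow> complex poly \<Rightarrow> cp1 multiset" where
  "form_zeros n p = image_mset Fin (proots p) + replicate_mset (n - degree p) Inf"

text \<open>Morphisms of the projective line to itself: pairs of binary forms of the same degree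
  without common zero.\<close>

definition regular_cp1 :: "(cp1 \<Rightarrow> cp1) \<Rightarrow> bool" where
  "regular_cp1 f \<longleftrightarrow> (\<exists>d p q. degree p \<le> d \<and> degree q \<le> d \<and>
     (\<forall>x. \<not> (bform d p x = 0 \<and> bform d q x = 0) \<and> f x = ratio (bform d p x) (bform d q x)))"


section \<open>Polynomials \<open>P(z; x, y)\<close> and the operations they define\<close>

text \<open>The outermost variable is \<open>x\<close>, the middle one \<open>y\<close>, the innermost one \<open>z\<close>.\<close>

type_synonym poly3 = "complex poly poly poly"

abbreviation const3 :: "complex \<Rightarrow> poly3" where "const3 c \<equiv> [:[:[:c:]:]:]"
abbreviation X3 :: poly3 where "X3 \<equiv> [:0, 1:]"
abbreviation Y3 :: poly3 where "Y3 \<equiv> [:[:0, 1:]:]"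
abbreviation Z3 :: poly3 where "Z3 \<equiv> [:[:[:0, 1:]:]:]"

definition coeff3 :: "poly3 \<Rightarrow> nat \<Rightarrow> nat \<Rightarrow> nat \<Rightarrow> complex" where
  "coeff3 P i j k = coeff (coeff (coeff P j) k) i" \<comment> \<open>the coefficient of \<open>z^i x^j y^k\<close>\<close>

definition eval3 :: "poly3 \<Rightarrow> complex \<Rightarrow> complex \<Rightarrow> complex \<Rightarrow> complex" where
  "eval3 P z x y = poly (poly (poly P [:[:x:]:]) [:y:]) z"

text \<open>The polynomial \<open>P(z; s x, s y)\<close>.\<close>

definition scale_xy :: "complex \<Rightarrow> poly3 \<Rightarrow> poly3" where
  "scale_xy s P = map_poly (\<lambda>Q. pcompose Q [:0, [:s:]:]) (pcompose P [:0, [:[:s:]:]:])"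

definition degrees_le :: "nat \<Rightarrow> nat \<Rightarrow> nat \<Rightarrow> poly3 \<Rightarrow> bool" where
  "degrees_le n d e P \<longleftrightarrow> (\<forall>i j k. coeff3 P i j k \<noteq> 0 \<longrightarrow> i \<le> n \<and> j \<le> d \<and> k \<le> e)"

text \<open>The trihomogeneous form \<open>z0^n x0^d y0^e P(z1/z0; x1/x0, y1/y0)\<close> at fixed \<open>x\<close> and \<open>y\<close>,
  dehomogenized in \<open>z\<close>.\<close>

definition form_at :: "nat \<Rightarrow> nat \<Rightarrow> poly3 \<Rightarrow> cp1 \<Rightarrow> cp1 \<Rightarrow> complex poly" where
  "form_at d e P x y =
     (\<Sum>j\<le>d. \<Sum>k\<le>e. smult (num x ^ j * den x ^ (d - j) * num y ^ k * den y ^ (e - k))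
                         (coeff (coeff P j) k))"

definition form_op :: "nat \<Rightarrow> nat \<Rightarrow> nat \<Rightarrow> poly3 \<Rightarrow> cp1 \<Rightarrow> cp1 \<Rightarrow> cp1 multiset option" where
  "form_op n d e P x y =
     (if form_at d e P x y = 0 then None else Some (form_zeros n (form_at d e P x y)))"


section \<open>Algebraic \<open>n\<close>-valued monoids\<close>

text \<open>All varieties that occur are curves parametrized by the projective line, so a variety is
  given by its set of points together with a coordinate, a bijection onto \<open>cp1\<close>.
  Multiplications are partial. An ordinary monoid is a 1-valued one, a point being identified with
  the one-element multiset that contains it.\<close>

record 'a nvmonoid =
  pts :: "'a set"
  crd :: "'a \<Rightarrow> cp1"
  mul :: "'a \<Rightarrow> 'a \<Rightarrow> 'a multiset option"
  neu :: 'a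

definition Sym :: "nat \<Rightarrow> 'a set \<Rightarrow> 'a multiset set" where
  "Sym n X = {m. size m = n \<and> set_mset m \<subseteq> X}"

text \<open>The union (with multiplicities) of the multisets \<open>f w\<close>, \<open>w \<in> W\<close>; defined iff all of
  them are.\<close>

definition mbind :: "'b multiset \<Rightarrow> ('b \<Rightarrow> 'a multiset option) \<Rightarrow> 'a multiset option" where
  "mbind W f =
     (if \<forall>w \<in># W. f w \<noteq> None then Some (\<Sum>w \<in># W. the (f w)) else None)"

text \<open>The symmetric power \<open>Sym n cp1\<close> is the projective space of binary forms of degree \<open>n\<close>, so a
  rational map \<open>cp1 \<times> cp1 \<rightarrow> Sym n cp1\<close> is given by a binary form of degree \<open>n\<close> whose coefficients
  are bihomogeneous of a common bidegree \<open>(d, e)\<close>.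
  In the associative law both sides are undefined or both are defined and equal.\<close>

definition algebraic_nvmonoid :: "nat \<Rightarrow> 'a nvmonoid \<Rightarrow> bool" where
  "algebraic_nvmonoid n M \<longleftrightarrow>
     bij_betw (crd M) (pts M) UNIV \<and>
     neu M \<in> pts M \<and>
     (\<forall>u \<in> pts M. \<forall>v \<in> pts M. \<forall>m. mul M u v = Some m \<longrightarrow> m \<in> Sym n (pts M)) \<and>
     (\<exists>d e P. P \<noteq> 0 \<and> degrees_le n d e P \<and>
        (\<forall>u \<in> pts M. \<forall>v \<in> pts M.
           map_option (image_mset (crd M)) (mul M u v) = form_op n d e P (crd M u) (crd M v))) \<and>
     (\<forall>u \<in> pts M. \<forall>v \<in> pts M. \<forall>w \<in> pts M.
        Option.bind (mul M v w) (\<lambda>W. mbind W (\<lambda>t. mul M u t)) =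
        Option.bind (mul M u v) (\<lambda>W. mbind W (\<lambda>t. mul M t w))) \<and>
     (\<forall>u \<in> pts M. mul M u (neu M) = Some (replicate_mset n u) \<and>
                   mul M (neu M) u = Some (replicate_mset n u))"

definition algebraic_map :: "'a nvmonoid \<Rightarrow> 'b nvmonoid \<Rightarrow> ('a \<Rightarrow> 'b) \<Rightarrow> bool" where
  "algebraic_map M N f \<longleftrightarrow> f ` pts M \<subseteq> pts N \<and>
     (\<exists>g. regular_cp1 g \<and> (\<forall>u \<in> pts M. crd N (f u) = g (crd M u)))"

definition nv_iso :: "('a \<Rightarrow> 'b) \<Rightarrow> 'a nvmonoid \<Rightarrow> 'b nvmonoid \<Rightarrow> bool" where
  "nv_iso f M N \<longleftrightarrow>
     bij_betw f (pts M) (pts N) \<and>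
     algebraic_map M N f \<and> algebraic_map N M (inv_into (pts M) f) \<and>
     f (neu M) = neu N \<and>
     (\<forall>u \<in> pts M. \<forall>v \<in> pts M. map_option (image_mset f) (mul M u v) = mul N (f u) (f v))"


section \<open>Coset monoids\<close>

text \<open>A finite group of automorphisms acting effectively; its order is \<open>card H\<close>.\<close>

definition aut_group :: "'a nvmonoid \<Rightarrow> ('a \<Rightarrow> 'a) set \<Rightarrow> bool" where
  "aut_group M H \<longleftrightarrow> finite H \<and>
     (\<forall>h \<in> H. nv_iso h M M) \<and>
     id \<in> H \<and> (\<forall>g \<in> H. \<forall>h \<in> H. g \<circ> h \<in> H) \<and> (\<forall>h \<in> H. \<exists>g \<in> H. g \<circ> h = id) \<and>
     (\<forall>g \<in> H. \<forall>h \<in> H. (\<forall>u \<in> pts M. g u = h u) \<longrightarrow> g = h)"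

text \<open>The quotient of a rational curve by a finite group is again a projective line; a morphism
  onto \<open>cp1\<close> whose fibres are precisely the orbits is the quotient map.\<close>

definition orbit_map :: "'a nvmonoid \<Rightarrow> ('a \<Rightarrow> 'a) set \<Rightarrow> ('a \<Rightarrow> cp1) \<Rightarrow> bool" where
  "orbit_map M H \<pi> \<longleftrightarrow>
     (\<exists>g. regular_cp1 g \<and> (\<forall>u \<in> pts M. \<pi> u = g (crd M u))) \<and>
     \<pi> ` pts M = UNIV \<and>
     (\<forall>u \<in> pts M. \<forall>v \<in> pts M. \<pi> u = \<pi> v \<longleftrightarrow> (\<exists>h \<in> H. v = h u))"

text \<open>The multiset \<open>[u \<cdot> h(v) | h \<in> H]\<close>.\<close>

definition coset_word ::
    "'a nvmonoid \<Rightarrow> ('a \<Rightarrow> 'a) set \<Rightarrow> 'a \<Rightarrow> 'a \<Rightarrow> 'a multiset option" where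
  "coset_word M H u v = mbind (mset_set H) (\<lambda>h. mul M u (h v))"

text \<open>\<open>N\<close>, living on the projective line \<open>M / H\<close>, is the coset monoid of \<open>M\<close> by \<open>H\<close> with
  projection \<open>\<pi>\<close>.\<close>

definition coset_monoid ::
    "'a nvmonoid \<Rightarrow> ('a \<Rightarrow> 'a) set \<Rightarrow> ('a \<Rightarrow> cp1) \<Rightarrow> cp1 nvmonoid \<Rightarrow> bool" where
  "coset_monoid M H \<pi> N \<longleftrightarrow>
     algebraic_nvmonoid 1 M \<and> aut_group M H \<and> orbit_map M H \<pi> \<and>
     pts N = UNIV \<and> crd N = id \<and> neu N = \<pi> (neu M) \<and>
     (\<forall>u \<in> pts M. \<forall>v \<in> pts M.
        mul N (\<pi> u) (\<pi> v) = map_option (image_mset \<pi>) (coset_word M H u v))"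

definition coset_isomorphic ::
    "'a nvmonoid \<Rightarrow> ('a \<Rightarrow> 'a) set \<Rightarrow> ('a \<Rightarrow> cp1) \<Rightarrow> cp1 nvmonoid \<Rightarrow>
     'b nvmonoid \<Rightarrow> ('b \<Rightarrow> 'b) set \<Rightarrow> ('b \<Rightarrow> cp1) \<Rightarrow> cp1 nvmonoid \<Rightarrow> bool" where
  "coset_isomorphic M A \<pi>\<^sub>M M\<^sub>A N B \<pi>\<^sub>N N\<^sub>B \<longleftrightarrow>
     coset_monoid M A \<pi>\<^sub>M M\<^sub>A \<and> coset_monoid N B \<pi>\<^sub>N N\<^sub>B \<and>
     (\<exists>\<Phi> \<phi>. nv_iso \<Phi> M N \<and> nv_iso \<phi> M\<^sub>A N\<^sub>B \<and>
        (\<forall>u \<in> pts M. \<phi> (\<pi>\<^sub>M u) = \<pi>\<^sub>N (\<Phi> u)) \<and>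
        (\<forall>u \<in> pts M. \<forall>v \<in> pts M.
           map_option (image_mset \<Phi>) (coset_word M A u v) = coset_word N B (\<Phi> u) (\<Phi> v)))"


section \<open>The monoids \<open>\<M>\<^sub>n\<close> on the projective line\<close>

definition cp1_monoid :: "nat \<Rightarrow> poly3 \<Rightarrow> cp1 nvmonoid" where
  "cp1_monoid n P = \<lparr>pts = UNIV, crd = id, mul = form_op n n n P, neu = Fin 0\<rparr>"

text \<open>Since every complex number is an \<open>n\<close>-th power, the defining identity determines
  \<open>p\<^sub>n(z; x, y)\<close> for \<open>n \<ge> 1\<close>.\<close>

definition pn :: "nat \<Rightarrow> poly3" where
  "pn n = (THE P. \<forall>u v w. eval3 P (w ^ n) (u ^ n) (v ^ n) =
     (\<Prod>r = 1..n. \<Prod>s = 1..n.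
        w + exp (2 * pi * \<i> / n) ^ r * u + exp (2 * pi * \<i> / n) ^ s * v))"

definition Mn :: "nat \<Rightarrow> cp1 nvmonoid" where
  "Mn n = cp1_monoid n (scale_xy ((- 1) ^ n) (pn n))"

text \<open>The additive monoid \<open>(z1 : z0) \<cdot> (w1 : w0) = (z1 w0 + z0 w1 : z0 w0)\<close>.\<close>

definition additive_monoid :: "cp1 nvmonoid" where
  "additive_monoid = \<lparr>pts = UNIV, crd = id,
     mul = (\<lambda>z w. if num z * den w + den z * num w = 0 \<and> den z * den w = 0 then None
                  else Some {#ratio (num z * den w + den z * num w) (den z * den w)#}),
     neu = Fin 0\<rparr>"

fun cp1_neg :: "cp1 \<Rightarrow> cp1" where
  "cp1_neg (Fin z) = Fin (- z)" | "cp1_neg Inf = Inf"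

fun cp1_square :: "cp1 \<Rightarrow> cp1" where
  "cp1_square (Fin z) = Fin (z\<^sup>2)" | "cp1_square Inf = Inf"


section \<open>The cuspidal cubic\<close>

definition proj_rel :: "complex \<times> complex \<times> complex \<Rightarrow> complex \<times> complex \<times> complex \<Rightarrow> bool" where
  "proj_rel = (\<lambda>(\<zeta>, \<eta>, \<tau>) v. (\<zeta>, \<eta>, \<tau>) \<noteq> 0 \<and> v \<noteq> 0 \<and> (\<exists>k. v = (k * \<zeta>, k * \<eta>, k * \<tau>)))"

lemma proj_rel_iff:
  "proj_rel (a, b, c) v \<longleftrightarrow> (a, b, c) \<noteq> 0 \<and> (\<exists>k. k \<noteq> 0 \<and> v = (k * a, k * b, k * c))"
  by (auto simp: proj_rel_def zero_prod_def)

lemma part_equivp_proj_rel: "part_equivp proj_rel"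
proof (rule part_equivpI)
  show "\<exists>u. proj_rel u u"
    by (rule exI[of _ "(1, 1, 1)"]) (auto simp: proj_rel_def zero_prod_def)
  show "symp proj_rel"
  proof (rule sympI)
    fix u v assume "proj_rel u v"
    moreover obtain a b c where u: "u = (a, b, c)" by (cases u) auto
    ultimately obtain k where "(a, b, c) \<noteq> 0" "k \<noteq> 0" "v = (k * a, k * b, k * c)"
      by (auto simp: proj_rel_iff)
    then show "proj_rel v u"
      unfolding u by (auto simp: proj_rel_iff zero_prod_def intro!: exI[of _ "inverse k"])
  qed
  show "transp proj_rel"
  proof (rule transpI)
    fix u v w assume *: "proj_rel u v" "proj_rel v w"
    obtain a b c where u: "u = (a, b, c)" by (cases u) auto
    with * obtain k where k: "(a, b, c) \<noteq> 0" "k \<noteq> 0" "v = (k * a, k * b, k * c)"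
      by (auto simp: proj_rel_iff)
    with * obtain l where "l \<noteq> 0" "w = (l * (k * a), l * (k * b), l * (k * c))"
      by (auto simp: proj_rel_iff)
    with k show "proj_rel u w"
      unfolding u by (auto simp: proj_rel_iff mult.assoc intro!: exI[of _ "l * k"])
  qed
qed

text \<open>Points \<open>(\<zeta> : \<eta> : \<tau>)\<close> of the projective plane; the affine chart is \<open>\<tau> = 1\<close>.\<close>

quotient_type cp2 = "complex \<times> complex \<times> complex" / partial: proj_rel
  by (rule part_equivp_proj_rel)

lift_definition on_cusp :: "complex \<Rightarrow> cp2 \<Rightarrow> bool" is
  "\<lambda>\<alpha> (\<zeta>, \<eta>, \<tau>). \<eta>\<^sup>2 * \<tau> = (\<zeta> - \<alpha> * \<tau>) ^ 3"
proof -
  fix \<alpha> :: complex and u v :: "complex \<times> complex \<times> complex"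
  assume r: "proj_rel u v"
  obtain a b c where u: "u = (a, b, c)" by (cases u) auto
  from r u obtain k where k: "k \<noteq> 0" "v = (k * a, k * b, k * c)" by (auto simp: proj_rel_iff)
  have e1: "(k * b)\<^sup>2 * (k * c) = k ^ 3 * (b\<^sup>2 * c)"
    by (simp add: power2_eq_square power3_eq_cube)
  have e2: "(k * a - \<alpha> * (k * c)) ^ 3 = k ^ 3 * (a - \<alpha> * c) ^ 3"
    by (simp add: power_mult_distrib[symmetric] right_diff_distrib mult.left_commute)
  have "(k * b)\<^sup>2 * (k * c) = (k * a - \<alpha> * (k * c)) ^ 3 \<longleftrightarrow> b\<^sup>2 * c = (a - \<alpha> * c) ^ 3"
    unfolding e1 e2 using k(1) by simp
  with k(2) show "(case u of (\<zeta>, \<eta>, \<tau>) \<Rightarrow> \<eta>\<^sup>2 * \<tau> = (\<zeta> - \<alpha> * \<tau>) ^ 3) =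
               (case v of (\<zeta>, \<eta>, \<tau>) \<Rightarrow> \<eta>\<^sup>2 * \<tau> = (\<zeta> - \<alpha> * \<tau>) ^ 3)"
    by (simp add: u)
qed

text \<open>The slope \<open>\<eta> / (\<zeta> - \<alpha>)\<close> of the line through the cusp \<open>(\<alpha>, 0)\<close> and the given point; at the
  cusp itself, the only point of the cubic with \<open>\<eta> = 0\<close>, the slope \<open>0\<close> of the cuspidal tangent.\<close>

lift_definition slope :: "complex \<Rightarrow> cp2 \<Rightarrow> cp1" is
  "\<lambda>\<alpha> (\<zeta>, \<eta>, \<tau>). if \<eta> = 0 then Fin 0 else ratio \<eta> (\<zeta> - \<alpha> * \<tau>)"
proof -
  fix \<alpha> :: complex and u v :: "complex \<times> complex \<times> complex"
  assume r: "proj_rel u v"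
  obtain a b c where u: "u = (a, b, c)" by (cases u) auto
  from r u obtain k where k: "k \<noteq> 0" "v = (k * a, k * b, k * c)" by (auto simp: proj_rel_iff)
  have "k * a - \<alpha> * (k * c) = k * (a - \<alpha> * c)" by algebra
  with k show "(case u of (\<zeta>, \<eta>, \<tau>) \<Rightarrow> if \<eta> = 0 then Fin 0 else ratio \<eta> (\<zeta> - \<alpha> * \<tau>)) =
               (case v of (\<zeta>, \<eta>, \<tau>) \<Rightarrow> if \<eta> = 0 then Fin 0 else ratio \<eta> (\<zeta> - \<alpha> * \<tau>))"
    by (simp add: u ratio_def)
qed

text \<open>The point of slope \<open>m\<close>: \<open>(\<zeta>, \<eta>) = (\<alpha> + m^2, m^3)\<close>, and \<open>(0 : 1 : 0)\<close> for \<open>m = \<infinity>\<close>.\<close>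

lift_definition cusp_point :: "complex \<Rightarrow> cp1 \<Rightarrow> cp2" is
  "\<lambda>\<alpha> m. (\<alpha> * den m ^ 3 + num m ^ 2 * den m, num m ^ 3, den m ^ 3)"
proof -
  fix \<alpha> :: complex and m :: cp1
  show "proj_rel (\<alpha> * den m ^ 3 + num m ^ 2 * den m, num m ^ 3, den m ^ 3)
                 (\<alpha> * den m ^ 3 + num m ^ 2 * den m, num m ^ 3, den m ^ 3)"
    by (cases m) (auto simp: proj_rel_iff zero_prod_def intro!: exI[of _ 1])
qed

lift_definition cusp_inv :: "cp2 \<Rightarrow> cp2" is "\<lambda>(\<zeta>, \<eta>, \<tau>). (\<zeta>, - \<eta>, \<tau>)"
proof -
  fix u v :: "complex \<times> complex \<times> complex"
  assume r: "proj_rel u v"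
  obtain a b c where u: "u = (a, b, c)" by (cases u) auto
  from r u obtain k where k: "(a, b, c) \<noteq> 0" "k \<noteq> 0" "v = (k * a, k * b, k * c)"
    by (auto simp: proj_rel_iff)
  then show "proj_rel (case u of (\<zeta>, \<eta>, \<tau>) \<Rightarrow> (\<zeta>, - \<eta>, \<tau>)) (case v of (\<zeta>, \<eta>, \<tau>) \<Rightarrow> (\<zeta>, - \<eta>, \<tau>))"
    by (auto simp: u proj_rel_iff zero_prod_def intro!: exI[of _ k])
qed

text \<open>\<open>m\<^sub>1 m\<^sub>2 / (m\<^sub>1 + m\<^sub>2)\<close>, written homogeneously.\<close>

definition slope_add :: "cp1 \<Rightarrow> cp1 \<Rightarrow> cp1 option" where
  "slope_add m1 m2 =
     (if num m1 * num m2 = 0 \<and> num m1 * den m2 + num m2 * den m1 = 0 then None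
      else Some (ratio (num m1 * num m2) (num m1 * den m2 + num m2 * den m1)))"

definition cusp_monoid :: "complex \<Rightarrow> cp2 nvmonoid" where
  "cusp_monoid \<alpha> = \<lparr>pts = {P. on_cusp \<alpha> P}, crd = slope \<alpha>,
     mul = (\<lambda>P Q. map_option (\<lambda>m. {#cusp_point \<alpha> m#}) (slope_add (slope \<alpha> P) (slope \<alpha> Q))),
     neu = cusp_point \<alpha> Inf\<rparr>"

lemma on_cusp_cusp_point: "on_cusp \<alpha> (cusp_point \<alpha> m)"
  by transfer (auto simp: power2_eq_square power3_eq_cube algebra_simps split: prod.splits)

lemma slope_cusp_point: "slope \<alpha> (cusp_point \<alpha> m) = m"
  by transfer (rename_tac \<alpha> m, case_tac m,
    auto simp: ratio_def power2_eq_square power3_eq_cube)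

lemma chord_identity:
  fixes s :: complex
  assumes "S = p1 * q2 + p2 * q1" "T = p1 * p2"
  shows "(q1 * q2 * T - S\<^sup>2) * (\<alpha> * t ^ 3 + s\<^sup>2 * t) + q1 * q2 * S * s ^ 3
          + (T\<^sup>2 - (q1 * q2 * T - S\<^sup>2) * \<alpha>) * t ^ 3
         = (q1 * s - p1 * t) * (q2 * s - p2 * t) * (S * s + T * t)"
proof -
  have *: "(q1 * s - p1 * t) * (q2 * s - p2 * t) = q1 * q2 * s\<^sup>2 - S * (s * t) + T * t\<^sup>2"
    unfolding assms by (simp add: algebra_simps power2_eq_square)
  show ?thesis
    unfolding * by (simp add: algebra_simps power2_eq_square power3_eq_cube)
qed

text \<open>\<open>slope_add\<close> is the chord-and-tangent addition: for \<open>m3\<close> the slope of the sum, some line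
  \<open>a \<zeta> + b \<eta> + c \<tau> = 0\<close> meets the cubic, with multiplicities, precisely at the points of slopes
  \<open>m1\<close>, \<open>m2\<close> and \<open>- m3\<close>.\<close>

lemma slope_add_chord:
  assumes "slope_add m1 m2 = Some m3"
  shows "\<exists>a b c k. k \<noteq> 0 \<and> (\<forall>s t.
     a * (\<alpha> * t ^ 3 + s\<^sup>2 * t) + b * s ^ 3 + c * t ^ 3 =
     k * ((den m1 * s - num m1 * t) * (den m2 * s - num m2 * t) * (den m3 * s + num m3 * t)))"
proof -
  define S where "S = num m1 * den m2 + num m2 * den m1"
  define T where "T = num m1 * num m2"
  have nz: "\<not> (T = 0 \<and> S = 0)" and m3: "m3 = ratio T S"
    using assms by (auto simp: slope_add_def S_def T_def split: if_splits)
  have "\<exists>k. k \<noteq> 0 \<and> T = k * num m3 \<and> S = k * den m3"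
  proof (cases "S = 0")
    case True
    with nz show ?thesis unfolding m3 by (intro exI[of _ T]) (simp add: ratio_def)
  next
    case False
    then show ?thesis unfolding m3 by (intro exI[of _ S]) (simp add: ratio_def)
  qed
  then obtain k where k: "k \<noteq> 0" "T = k * num m3" "S = k * den m3"
    by blast
  define a where "a = den m1 * den m2 * T - S\<^sup>2"
  have "a * (\<alpha> * t ^ 3 + s\<^sup>2 * t) + den m1 * den m2 * S * s ^ 3 + (T\<^sup>2 - a * \<alpha>) * t ^ 3 =
     k * ((den m1 * s - num m1 * t) * (den m2 * s - num m2 * t) * (den m3 * s + num m3 * t))"
    for s t
  proof -
    have "S * s + T * t = k * (den m3 * s + num m3 * t)"
      unfolding k(2,3) by (simp add: algebra_simps)
    then show ?thesis
      unfolding a_def chord_identity[OF S_def T_def] by simp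
  qed
  with k(1) show ?thesis by blast
qed


section \<open>The polynomials of the three families of groups\<close>

definition coeffwise_limit :: "(complex \<Rightarrow> poly3) \<Rightarrow> poly3 \<Rightarrow> bool" where
  "coeffwise_limit P P\<^sub>0 \<longleftrightarrow>
     (\<forall>i j k. ((\<lambda>c. coeff3 (P c) i j k) \<longlongrightarrow> coeff3 P\<^sub>0 i j k) (at 0))"

definition \<sigma>\<^sub>1 :: poly3 where "\<sigma>\<^sub>1 = X3 + Y3 + Z3"
definition \<sigma>\<^sub>2 :: poly3 where "\<sigma>\<^sub>2 = X3 * Y3 + Y3 * Z3 + Z3 * X3"
definition \<sigma>\<^sub>3 :: poly3 where "\<sigma>\<^sub>3 = X3 * Y3 * Z3"

definition p3 :: "complex \<Rightarrow> poly3" where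
  "p3 c' = (let c = const3 c' in
     \<sigma>\<^sub>1^3 - 27 * \<sigma>\<^sub>3 + 18 * c * \<sigma>\<^sub>1^2 * \<sigma>\<^sub>3 - 54 * c * \<sigma>\<^sub>2 * \<sigma>\<^sub>3
     - 27 * c^2 * \<sigma>\<^sub>2^2 * \<sigma>\<^sub>3 + 81 * c^2 * \<sigma>\<^sub>1 * \<sigma>\<^sub>3^2)"

definition p4 :: "complex \<Rightarrow> poly3" where
  "p4 b' = (let b = const3 b' in
     \<sigma>\<^sub>1^4 - 8 * \<sigma>\<^sub>1^2 * \<sigma>\<^sub>2 + 16 * \<sigma>\<^sub>2^2 - 128 * \<sigma>\<^sub>1 * \<sigma>\<^sub>3 - 112 * b * \<sigma>\<^sub>1^2 * \<sigma>\<^sub>3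
     - 4 * b^2 * \<sigma>\<^sub>1^3 * \<sigma>\<^sub>3 - 64 * b * \<sigma>\<^sub>2 * \<sigma>\<^sub>3 - 112 * b^2 * \<sigma>\<^sub>1 * \<sigma>\<^sub>2 * \<sigma>\<^sub>3 - 64 * b^2 * \<sigma>\<^sub>3^2
     - 288 * b^3 * \<sigma>\<^sub>1 * \<sigma>\<^sub>3^2 + 6 * b^4 * \<sigma>\<^sub>1^2 * \<sigma>\<^sub>3^2 - 136 * b^4 * \<sigma>\<^sub>2 * \<sigma>\<^sub>3^2
     - 112 * b^5 * \<sigma>\<^sub>3^3 - 4 * b^6 * \<sigma>\<^sub>1 * \<sigma>\<^sub>3^3 + b^8 * \<sigma>\<^sub>3^4)"

definition p6 :: "complex \<Rightarrow> poly3" where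
  "p6 c' = (let c = const3 c' in
     \<sigma>\<^sub>1^6 - 2^2 * 3 * \<sigma>\<^sub>1^4 * \<sigma>\<^sub>2 + 2^4 * 3 * \<sigma>\<^sub>1^2 * \<sigma>\<^sub>2^2 - 2^6 * \<sigma>\<^sub>2^3
     - 2 * 3^4 * 17 * \<sigma>\<^sub>1^3 * \<sigma>\<^sub>3 - 2^3 * 3^4 * 19 * \<sigma>\<^sub>1 * \<sigma>\<^sub>2 * \<sigma>\<^sub>3 + 3^3 * 19^3 * \<sigma>\<^sub>3^2
     - 2^5 * 3^2 * 11 * c * \<sigma>\<^sub>1^4 * \<sigma>\<^sub>3 - 2^2 * 3^3 * 5 * c^2 * \<sigma>\<^sub>1^5 * \<sigma>\<^sub>3
     - 2^4 * 3^2 * 211 * c * \<sigma>\<^sub>1^2 * \<sigma>\<^sub>2 * \<sigma>\<^sub>3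
     - 2^2 * 3^3 * 197 * c^2 * \<sigma>\<^sub>1^3 * \<sigma>\<^sub>2 * \<sigma>\<^sub>3 - 2^3 * 3^5 * c^3 * \<sigma>\<^sub>1^4 * \<sigma>\<^sub>2 * \<sigma>\<^sub>3
     - 2^6 * 3^2 * 5^2 * c * \<sigma>\<^sub>2^2 * \<sigma>\<^sub>3
     - 2^4 * 3^3 * 107 * c^2 * \<sigma>\<^sub>1 * \<sigma>\<^sub>2^2 * \<sigma>\<^sub>3 - 2^4 * 3^7 * c^3 * \<sigma>\<^sub>1^2 * \<sigma>\<^sub>2^2 * \<sigma>\<^sub>3
     - 2 * 3^6 * c^4 * \<sigma>\<^sub>1^3 * \<sigma>\<^sub>2^2 * \<sigma>\<^sub>3
     - 2^6 * 3^5 * c^3 * \<sigma>\<^sub>2^3 * \<sigma>\<^sub>3 - 2^3 * 3^7 * c^4 * \<sigma>\<^sub>1 * \<sigma>\<^sub>2^3 * \<sigma>\<^sub>3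
     + 2^4 * 3^3 * 7^2 * 19 * c * \<sigma>\<^sub>1 * \<sigma>\<^sub>3^2
     + 2^2 * 3^3 * 47 * 53 * c^2 * \<sigma>\<^sub>1^2 * \<sigma>\<^sub>3^2 + 2^3 * 3^5 * 61 * c^3 * \<sigma>\<^sub>1^3 * \<sigma>\<^sub>3^2
     + 2 * 3^7 * 17 * c^4 * \<sigma>\<^sub>1^4 * \<sigma>\<^sub>3^2
     + 2^2 * 3^4 * 701 * c^2 * \<sigma>\<^sub>2 * \<sigma>\<^sub>3^2 + 2^3 * 3^6 * 7 * 13 * c^3 * \<sigma>\<^sub>1 * \<sigma>\<^sub>2 * \<sigma>\<^sub>3^2
     + 2^10 * 3^6 * c^4 * \<sigma>\<^sub>1^2 * \<sigma>\<^sub>2 * \<sigma>\<^sub>3^2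
     + 2^4 * 3^8 * 5 * c^5 * \<sigma>\<^sub>1^3 * \<sigma>\<^sub>2 * \<sigma>\<^sub>3^2 + 2 * 3^7 * 5 * 17 * c^4 * \<sigma>\<^sub>2^2 * \<sigma>\<^sub>3^2
     + 2^5 * 3^8 * 7 * c^5 * \<sigma>\<^sub>1 * \<sigma>\<^sub>2^2 * \<sigma>\<^sub>3^2
     + 2^2 * 3^9 * 17 * c^6 * \<sigma>\<^sub>1^2 * \<sigma>\<^sub>2^2 * \<sigma>\<^sub>3^2 + 2^2 * 3^9 * 11 * c^6 * \<sigma>\<^sub>2^3 * \<sigma>\<^sub>3^2
     + 2^3 * 3^11 * c^7 * \<sigma>\<^sub>1 * \<sigma>\<^sub>2^3 * \<sigma>\<^sub>3^2 + 3^12 * c^8 * \<sigma>\<^sub>2^4 * \<sigma>\<^sub>3^2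
     - 2^3 * 3^12 * c^3 * \<sigma>\<^sub>3^3 - 2 * 3^9 * 5 * 47 * c^4 * \<sigma>\<^sub>1 * \<sigma>\<^sub>3^3
     - 2^4 * 3^9 * 17 * c^5 * \<sigma>\<^sub>1^2 * \<sigma>\<^sub>3^3 - 2^2 * 3^9 * 5 * c^6 * \<sigma>\<^sub>1^3 * \<sigma>\<^sub>3^3
     - 2^6 * 3^11 * c^5 * \<sigma>\<^sub>2 * \<sigma>\<^sub>3^3 - 2^2 * 3^10 * 5 * 11 * c^6 * \<sigma>\<^sub>1 * \<sigma>\<^sub>2 * \<sigma>\<^sub>3^3
     - 2^3 * 3^11 * c^7 * \<sigma>\<^sub>1^2 * \<sigma>\<^sub>2 * \<sigma>\<^sub>3^3 - 2^3 * 3^11 * 5 * c^7 * \<sigma>\<^sub>2^2 * \<sigma>\<^sub>3^3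
     - 2 * 3^12 * c^8 * \<sigma>\<^sub>1 * \<sigma>\<^sub>2^2 * \<sigma>\<^sub>3^3 - 2^3 * 3^12 * c^6 * \<sigma>\<^sub>3^4
     - 2^3 * 3^12 * c^7 * \<sigma>\<^sub>1 * \<sigma>\<^sub>3^4 + 3^12 * c^8 * \<sigma>\<^sub>1^2 * \<sigma>\<^sub>3^4
     - 2^2 * 3^13 * c^8 * \<sigma>\<^sub>2 * \<sigma>\<^sub>3^4)"

text \<open>The polynomials in \<open>(z; x, y)\<close> that define the multiplications of the groups
  \<open>\<G>\<^sub>3\<close>, \<open>\<G>\<^sub>4\<close> and \<open>\<G>\<^sub>6\<close>.\<close>

definition G3_poly :: "complex \<Rightarrow> poly3" where "G3_poly c = scale_xy (- 1) (p3 c)"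
definition G4_poly :: "complex \<Rightarrow> poly3" where "G4_poly b = p4 b"
definition G6_poly :: "complex \<Rightarrow> poly3" where "G6_poly c = p6 c"

end

theory Submission
  imports Defs
begin

text \<open>The smooth points of the cuspidal cubic form the additive group: in the inverse \<open>u = 1/m\<close> of the slope
the partial operation \<open>m\<^sub>1 m\<^sub>2 / (m\<^sub>1 + m\<^sub>2)\<close> is addition on \<open>\<complex> \<union> {\<infinity>}\<close>, and the involution is
\<open>u \<mapsto> - u\<close>. The cubics for different \<open>\<alpha>\<close>, and the additive monoid itself, thus differ only in the
coordinate; this is captured by the locales \<open>additive_chart\<close> and \<open>square_chart\<close>.

Uniqueness rests on \<open>regular_even_quotient\<close>: a regular self-map of the projective line whose fibres
are the pairs \<open>{x, - x}\<close> is \<open>x\<^sup>2\<close> followed by a homography. Hence every orbit map is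
\<open>S (u\<^sup>2)\<close> for some homography \<open>S\<close>, and the coset monoid can only be the operation with values
\<open>S ((u + v)\<^sup>2)\<close> and \<open>S ((u - v)\<^sup>2)\<close>. These are the zeros of an explicit polynomial of degree at most
\<open>2\<close> in each variable (\<open>square_poly\<close>, \<open>form_op_square_poly\<close>), which for \<open>S = id\<close> is \<open>p\<^sub>2\<close>. So the
coset monoid is algebraic, and matching points with equal \<open>u\<close> is a coset-isomorphism between any
two of these monoids (\<open>coset_isomorphic_charts\<close>), in particular onto \<open>\<M>\<^sub>2\<close>.

For the three limits, the coefficients depend continuously on the parameter, and it remains to
recognize \<open>p\<^sub>3\<close>, \<open>p\<^sub>4\<close> and \<open>p\<^sub>6\<close> in the polynomials with parameter \<open>0\<close>. The product over the roots of
unity is evaluated in two stages: \<open>p\<^sub>3\<close> is elementary, while \<open>p\<^sub>4\<close> and \<open>p\<^sub>6\<close> are products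
of four values of \<open>p\<^sub>2\<close> and of \<open>p\<^sub>3\<close> over the signs of two square roots.\<close>

section \<open>Polynomials in three variables\<close>

lemma poly_eqI_infinite:
  fixes p q :: "'a::idom poly"
  assumes "infinite S" "\<And>a. a \<in> S \<Longrightarrow> poly p a = poly q a"
  shows "p = q"
proof (rule ccontr)
  assume "p \<noteq> q"
  hence "finite {a. poly (p - q) a = 0}"
    by (intro poly_roots_finite) simp
  moreover have "S \<subseteq> {a. poly (p - q) a = 0}"
    using assms(2) by auto
  ultimately show False
    using assms(1) finite_subset by blast
qed

lemma eval3_eqI:
  assumes "\<And>z x y. eval3 P z x y = eval3 Q z x y"
  shows "P = Q"
proof -
  have inf: "infinite (range (\<lambda>a::complex. [:a:]))" "infinite (range (\<lambda>a::complex. [:[:a:]:]))"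
    by (simp_all add: finite_image_iff inj_def infinite_UNIV_char_0)
  have "poly (poly P [:[:x:]:]) [:y:] = poly (poly Q [:[:x:]:]) [:y:]" for x y
    using assms by (intro poly_eqI_infinite[OF infinite_UNIV_char_0]) (simp add: eval3_def)
  hence "poly P [:[:x:]:] = poly Q [:[:x:]:]" for x
    by (intro poly_eqI_infinite[OF inf(1)]) auto
  thus ?thesis
    by (intro poly_eqI_infinite[OF inf(2)]) auto
qed

lemma eval3_ring [simp]:
  "eval3 (P + Q) z x y = eval3 P z x y + eval3 Q z x y"
  "eval3 (P - Q) z x y = eval3 P z x y - eval3 Q z x y"
  "eval3 (P * Q) z x y = eval3 P z x y * eval3 Q z x y"
  "eval3 (P ^ k) z x y = eval3 P z x y ^ k"
  "eval3 (numeral m) z x y = numeral m"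
  "eval3 1 z x y = 1" "eval3 0 z x y = 0" "eval3 (- P) z x y = - eval3 P z x y"
  by (simp_all add: eval3_def poly_power poly_numeral)

lemma eval3_sigma:
  "eval3 \<sigma>\<^sub>1 z x y = x + y + z"
  "eval3 \<sigma>\<^sub>2 z x y = x * y + y * z + z * x"
  "eval3 \<sigma>\<^sub>3 z x y = x * y * z"
  by (simp_all add: eval3_def algebra_simps \<sigma>\<^sub>1_def \<sigma>\<^sub>2_def \<sigma>\<^sub>3_def)


section \<open>The polynomials \<open>p\<^sub>n\<close> for small \<open>n\<close>\<close>

text \<open>Every complex number is an \<open>n\<close>-th power, so the values on \<open>n\<close>-th powers determine a polynomial;
a formula for \<open>p\<^sub>n\<close> can therefore be verified on the factors.\<close>
lemma pn_eqI:
  assumes "n > 0"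
  assumes "\<And>u v w. eval3 P (w ^ n) (u ^ n) (v ^ n) =
    (\<Prod>r = 1..n. \<Prod>s = 1..n.
        w + exp (2 * pi * \<i> / n) ^ r * u + exp (2 * pi * \<i> / n) ^ s * v)"
  shows "pn n = P"
  unfolding pn_def
proof (rule the_equality)
  fix Q :: poly3
  assume Q: "\<forall>u v w. eval3 Q (w ^ n) (u ^ n) (v ^ n) =
    (\<Prod>r = 1..n. \<Prod>s = 1..n.
        w + exp (2 * pi * \<i> / n) ^ r * u + exp (2 * pi * \<i> / n) ^ s * v)"
  show "Q = P"
  proof (rule eval3_eqI)
    fix z x y :: complex
    obtain w u v where "z = w ^ n" "x = u ^ n" "y = v ^ n"
      using exists_complex_root \<open>n > 0\<close> by (metis less_numeral_extra(3))
    thus "eval3 Q z x y = eval3 P z x y"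
      using Q assms(2) by simp
  qed
qed (use assms(2) in blast)

lemma exp_root_2: "exp (2 * pi * \<i> / (2::nat)) = -1"
  by simp

lemma exp_root_4: "exp (2 * pi * \<i> / (4::nat)) = \<i>"
proof -
  have "2 * pi * \<i> / (4::nat) = \<i> * complex_of_real (pi / 2)" by simp
  thus ?thesis by (simp only: cis_conv_exp[symmetric] cis_pi_half)
qed

lemma exp_root_3:
  assumes "\<omega> = exp (2 * pi * \<i> / (3::nat))" shows "\<omega>\<^sup>2 = - 1 - \<omega>"
proof -
  have "2 * pi * \<i> / (3::nat) = \<i> * complex_of_real (2 * pi / 3)" by simp
  hence "\<omega> = cis (2 * pi / 3)" unfolding assms by (simp only: cis_conv_exp)
  hence \<omega>: "\<omega> = Complex (- 1 / 2) (sqrt 3 / 2)" by (simp add: complex_eq_iff cos_120 sin_120)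
  show ?thesis
    unfolding \<omega> by (simp add: complex_eq_iff power2_eq_square)
qed

lemma exp_root_6:
  assumes "\<epsilon> = exp (2 * pi * \<i> / (6::nat))" shows "\<epsilon>\<^sup>2 = \<epsilon> - 1"
proof -
  have "2 * pi * \<i> / (6::nat) = \<i> * complex_of_real (pi / 3)" by simp
  hence "\<epsilon> = cis (pi / 3)" unfolding assms by (simp only: cis_conv_exp)
  hence \<epsilon>: "\<epsilon> = Complex (1 / 2) (sqrt 3 / 2)" by (simp add: complex_eq_iff cos_60 sin_60)
  show ?thesis
    unfolding \<epsilon> by (simp add: complex_eq_iff power2_eq_square)
qed

text \<open>The polynomials \<open>p\<^sub>2(a; b, c)\<close> and \<open>p\<^sub>3(a; b, c)\<close>, evaluated at complex numbers.\<close>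
definition quadric :: "complex \<Rightarrow> complex \<Rightarrow> complex \<Rightarrow> complex" where
  "quadric a b c = a\<^sup>2 + b\<^sup>2 + c\<^sup>2 - 2 * a * b - 2 * b * c - 2 * c * a"

definition cubic :: "complex \<Rightarrow> complex \<Rightarrow> complex \<Rightarrow> complex" where
  "cubic a b c = (a + b + c) ^ 3 - 27 * a * b * c"

lemma quadric_factors: "((w + u)\<^sup>2 - t) * ((w - u)\<^sup>2 - t) = quadric (w\<^sup>2) (u\<^sup>2) t"
  unfolding quadric_def by algebra

text \<open>For \<open>t = v\<^sup>3\<close> each factor on the left is itself the product of \<open>w + \<omega>\<^sup>r u + \<omega>\<^sup>s v\<close> over \<open>s\<close>. The
free \<open>t\<close> makes the identity available for \<open>t = - v\<^sup>3\<close> as well, which the case \<open>n = 6\<close> uses.\<close>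
lemma cubic_factors:
  assumes "\<omega>\<^sup>2 = - 1 - \<omega>"
  shows "((w + u) ^ 3 + t) * ((w + \<omega> * u) ^ 3 + t) * ((w + \<omega>\<^sup>2 * u) ^ 3 + t)
           = cubic (w ^ 3) (u ^ 3) t"
  unfolding cubic_def using assms by algebra

lemma eval3_p3_0: "eval3 (p3 0) z x y = cubic z x y"
  by (simp add: p3_def eval3_sigma cubic_def algebra_simps)

text \<open>A fourth root of unity is a square root of \<open>\<plusminus> 1\<close>, so \<open>p\<^sub>4\<close> is \<open>p\<^sub>2\<close> multiplied over the signs of two
square roots; likewise a sixth root of unity is a cube root of \<open>\<plusminus> 1\<close>, and \<open>p\<^sub>6\<close> is \<open>p\<^sub>3\<close> multiplied
over signs. On squares both statements are polynomial identities.\<close>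
lemma eval3_p4_0: "eval3 (p4 0) (a\<^sup>2) (b\<^sup>2) (c\<^sup>2) =
    quadric a b c * quadric a b (- c) * (quadric a (- b) c * quadric a (- b) (- c))"
  unfolding p4_def quadric_def Let_def
  by (simp add: eval3_sigma) algebra

lemma eval3_p6_0: "eval3 (p6 0) (a\<^sup>2) (b\<^sup>2) (c\<^sup>2) =
    cubic a b c * cubic a b (- c) * (cubic a (- b) c * cubic a (- b) (- c))"
  unfolding p6_def cubic_def Let_def
  by (simp add: eval3_sigma) algebra

lemma prod_1_to:
  fixes f :: "nat \<Rightarrow> 'a::comm_monoid_mult"
  shows "(\<Prod>r = 1..2. f r) = f 1 * f 2"
        "(\<Prod>r = 1..3. f r) = f 1 * f 2 * f 3"
        "(\<Prod>r = 1..4. f r) = f 1 * f 2 * f 3 * f 4"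
        "(\<Prod>r = 1..6. f r) = f 1 * f 2 * f 3 * f 4 * f 5 * f 6"
  by (simp_all add: eval_nat_numeral mult.assoc)

lemma pn_3: "pn 3 = p3 0"
proof (rule pn_eqI)
  fix u v w :: complex
  define \<omega> where "\<omega> = exp (2 * pi * \<i> / (3::nat))"
  note \<omega> = exp_root_3[OF \<omega>_def]
  have "\<omega> ^ 3 = 1" using \<omega> by algebra
  have inner: "(\<Prod>s = 1..3. A + \<omega> ^ s * v) = A ^ 3 + v ^ 3" for A
    unfolding prod_1_to using \<omega> by algebra
  have "(\<Prod>r = 1..3. \<Prod>s = 1..3. w + \<omega> ^ r * u + \<omega> ^ s * v)
      = ((w + u) ^ 3 + v ^ 3) * ((w + \<omega> * u) ^ 3 + v ^ 3) * ((w + \<omega>\<^sup>2 * u) ^ 3 + v ^ 3)"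
    unfolding inner prod_1_to by (simp add: \<open>\<omega> ^ 3 = 1\<close> mult_ac)
  also have "\<dots> = eval3 (p3 0) (w ^ 3) (u ^ 3) (v ^ 3)"
    by (simp only: cubic_factors[OF \<omega>] eval3_p3_0)
  finally show "eval3 (p3 0) (w ^ 3) (u ^ 3) (v ^ 3) =
      (\<Prod>r = 1..3. \<Prod>s = 1..3.
         w + exp (2 * pi * \<i> / (3::nat)) ^ r * u + exp (2 * pi * \<i> / (3::nat)) ^ s * v)"
    by (simp only: \<omega>_def)
qed simp

lemma pn_4: "pn 4 = p4 0"
proof (rule pn_eqI)
  fix u v w :: complex
  have i: "\<i> ^ 3 = - \<i>" "\<i> ^ 4 = 1" by (simp_all add: eval_nat_numeral)
  have inner: "(\<Prod>s = 1..4. A + \<i> ^ s * v) = (A\<^sup>2 - v\<^sup>2) * (A\<^sup>2 - - v\<^sup>2)" for A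
    unfolding prod_1_to using i_squared i by algebra
  have "(\<Prod>r = 1..4. \<Prod>s = 1..4. w + \<i> ^ r * u + \<i> ^ s * v)
      = ((w + u)\<^sup>2 - v\<^sup>2) * ((w - u)\<^sup>2 - v\<^sup>2) * (((w + u)\<^sup>2 - - v\<^sup>2) * ((w - u)\<^sup>2 - - v\<^sup>2)) *
       (((w + \<i> * u)\<^sup>2 - v\<^sup>2) * ((w - \<i> * u)\<^sup>2 - v\<^sup>2) *
        (((w + \<i> * u)\<^sup>2 - - v\<^sup>2) * ((w - \<i> * u)\<^sup>2 - - v\<^sup>2)))"
    unfolding inner prod_1_to i by (simp add: mult_ac)
  also have "\<dots> = eval3 (p4 0) ((w\<^sup>2)\<^sup>2) ((u\<^sup>2)\<^sup>2) ((v\<^sup>2)\<^sup>2)"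
    unfolding quadric_factors eval3_p4_0 by (simp add: power_mult_distrib)
  finally show "eval3 (p4 0) (w ^ 4) (u ^ 4) (v ^ 4) =
      (\<Prod>r = 1..4. \<Prod>s = 1..4.
         w + exp (2 * pi * \<i> / (4::nat)) ^ r * u + exp (2 * pi * \<i> / (4::nat)) ^ s * v)"
    unfolding exp_root_4 by (simp add: power_mult[symmetric])
qed simp

lemma pn_6: "pn 6 = p6 0"
proof (rule pn_eqI)
  fix u v w :: complex
  define \<epsilon> where "\<epsilon> = exp (2 * pi * \<i> / (6::nat))"
  define \<omega> where "\<omega> = \<epsilon>\<^sup>2"
  note \<epsilon> = exp_root_6[OF \<epsilon>_def]
  have \<omega>: "\<omega>\<^sup>2 = - 1 - \<omega>" unfolding \<omega>_def using \<epsilon> by algebra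
  \<comment> \<open>The sixth roots of unity are the cube roots of unity up to sign.\<close>
  have pow: "\<epsilon> ^ 1 = - (\<omega>\<^sup>2)" "\<epsilon> ^ 3 = - 1" "\<epsilon> ^ 4 = \<omega>\<^sup>2" "\<epsilon> ^ 5 = - \<omega>" "\<epsilon> ^ 6 = 1"
    unfolding \<omega>_def using \<epsilon> by algebra+
  have pow2: "\<epsilon> ^ 2 = \<omega>" by (simp add: \<omega>_def)
  have inner: "(\<Prod>s = 1..6. A + \<epsilon> ^ s * v) = (A ^ 3 + v ^ 3) * (A ^ 3 + - (v ^ 3))" for A
    unfolding prod_1_to pow pow2 using \<omega> by algebra
  have "(\<Prod>r = 1..6. \<Prod>s = 1..6. w + \<epsilon> ^ r * u + \<epsilon> ^ s * v)
      = ((w + u) ^ 3 + v ^ 3) * ((w + \<omega> * u) ^ 3 + v ^ 3) * ((w + \<omega>\<^sup>2 * u) ^ 3 + v ^ 3) *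
        (((w + u) ^ 3 + - (v ^ 3)) * ((w + \<omega> * u) ^ 3 + - (v ^ 3)) * ((w + \<omega>\<^sup>2 * u) ^ 3 + - (v ^ 3))) *
        (((w + - u) ^ 3 + v ^ 3) * ((w + \<omega> * - u) ^ 3 + v ^ 3) * ((w + \<omega>\<^sup>2 * - u) ^ 3 + v ^ 3) *
        (((w + - u) ^ 3 + - (v ^ 3)) * ((w + \<omega> * - u) ^ 3 + - (v ^ 3)) *
         ((w + \<omega>\<^sup>2 * - u) ^ 3 + - (v ^ 3))))"
    unfolding inner prod_1_to pow pow2 by (simp add: mult_ac)
  also have "\<dots> = eval3 (p6 0) ((w ^ 3)\<^sup>2) ((u ^ 3)\<^sup>2) ((v ^ 3)\<^sup>2)"
    unfolding cubic_factors[OF \<omega>] eval3_p6_0 by simp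
  finally show "eval3 (p6 0) (w ^ 6) (u ^ 6) (v ^ 6) =
      (\<Prod>r = 1..6. \<Prod>s = 1..6.
         w + exp (2 * pi * \<i> / (6::nat)) ^ r * u + exp (2 * pi * \<i> / (6::nat)) ^ s * v)"
    by (simp add: power_mult[symmetric] \<epsilon>_def)
qed simp

section \<open>Coefficientwise limits\<close>

lemma coeff3_scale_xy: "coeff3 (scale_xy s P) i j k = s ^ (j + k) * coeff3 P i j k"
  by (simp add: coeff3_def scale_xy_def coeff_map_poly coeff_pcompose_linear pcompose_smult
      power_add poly_const_pow)

lemma scale_xy_1: "scale_xy 1 P = P"
proof -
  have "coeff3 (scale_xy 1 P) i j k = coeff3 P i j k" for i j k
    by (simp add: coeff3_scale_xy)
  thus ?thesis
    by (simp add: coeff3_def poly_eq_iff)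
qed

definition continuous_family :: "(complex \<Rightarrow> poly3) \<Rightarrow> bool" where
  "continuous_family F \<longleftrightarrow> (\<forall>i j k. continuous_on UNIV (\<lambda>c. coeff3 (F c) i j k))"

named_theorems continuous_family_intros

lemma continuous_family_const [continuous_family_intros]: "continuous_family (\<lambda>c. P)"
  by (simp add: continuous_family_def)

lemma continuous_family_parameter [continuous_family_intros]: "continuous_family const3"
proof -
  have "coeff3 (const3 c) i j k = (if i = 0 \<and> j = 0 \<and> k = 0 then c else 0)" for c i j k
    by (simp add: coeff3_def coeff_pCons split: nat.split)
  hence "continuous_on UNIV (\<lambda>c. coeff3 (const3 c) i j k)" for i j k
    by (cases "i = 0 \<and> j = 0 \<and> k = 0") auto
  thus ?thesis by (simp add: continuous_family_def)
qed

lemma continuous_family_add [continuous_family_intros]: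
  "continuous_family F \<Longrightarrow> continuous_family G \<Longrightarrow> continuous_family (\<lambda>c. F c + G c)"
  by (auto simp: continuous_family_def coeff3_def intro: continuous_intros)

lemma continuous_family_diff [continuous_family_intros]:
  "continuous_family F \<Longrightarrow> continuous_family G \<Longrightarrow> continuous_family (\<lambda>c. F c - G c)"
  by (auto simp: continuous_family_def coeff3_def intro: continuous_intros)

lemma coeff3_mult:
  "coeff3 (P * Q) i j k =
     (\<Sum>a\<le>j. \<Sum>b\<le>k. \<Sum>c\<le>i. coeff3 P c a b * coeff3 Q (i - c) (j - a) (k - b))"
  by (simp add: coeff3_def coeff_mult coeff_sum)

lemma continuous_family_mult [continuous_family_intros]:
  "continuous_family F \<Longrightarrow> continuous_family G \<Longrightarrow> continuous_family (\<lambda>c. F c * G c)"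
  unfolding continuous_family_def coeff3_mult by (intro allI continuous_intros) auto

lemma continuous_family_power [continuous_family_intros]:
  "continuous_family F \<Longrightarrow> continuous_family (\<lambda>c. F c ^ m)"
  by (induction m) (auto intro: continuous_family_intros)

lemma continuous_family_scale_xy [continuous_family_intros]:
  "continuous_family F \<Longrightarrow> continuous_family (\<lambda>c. scale_xy s (F c))"
  by (auto simp: continuous_family_def coeff3_scale_xy intro: continuous_intros)

lemma continuous_family_limit: "continuous_family F \<Longrightarrow> coeffwise_limit F (F 0)"
  by (auto simp: continuous_family_def coeffwise_limit_def continuous_on_def)

text \<open>The coefficients of the three families are polynomials in the parameter, hence continuous, and the
limit is the value at \<open>0\<close>.\<close>
lemma coeffwise_limits:
  "coeffwise_limit G3_poly (G3_poly 0)"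
  "coeffwise_limit G4_poly (G4_poly 0)"
  "coeffwise_limit G6_poly (G6_poly 0)"
  unfolding G3_poly_def G4_poly_def G6_poly_def p3_def p4_def p6_def Let_def
  by (rule continuous_family_limit, intro continuous_family_intros)+

lemma limit_monoids:
  "cp1_monoid 3 (G3_poly 0) = Mn 3"
  "cp1_monoid 4 (G4_poly 0) = Mn 4"
  "cp1_monoid 6 (G6_poly 0) = Mn 6"
  by (simp_all add: Mn_def pn_3 pn_4 pn_6 G3_poly_def G4_poly_def G6_poly_def scale_xy_1)

section \<open>Homographies of the projective line\<close>

lemma num_den_nonzero: "num x \<noteq> 0 \<or> den x \<noteq> 0"
  by (cases x) auto

lemma ratio_num_den [simp]: "ratio (num x) (den x) = x"
  by (cases x) (auto simp: ratio_def)

lemma ratio_scale: "k \<noteq> 0 \<Longrightarrow> ratio (k * a) (k * b) = ratio a b"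
  by (simp add: ratio_def)

lemma ratio_coordsE:
  assumes "a \<noteq> 0 \<or> b \<noteq> 0"
  obtains k where "k \<noteq> 0" "a = k * num (ratio a b)" "b = k * den (ratio a b)"
  using assms that[of b] that[of a] by (cases "b = 0") (auto simp: ratio_def)

lemma ratio_eq_iff:
  assumes "a \<noteq> 0 \<or> b \<noteq> 0"
  shows "ratio a b = x \<longleftrightarrow> a * den x = b * num x"
  using assms by (cases x) (auto simp: ratio_def field_simps)

definition moebius :: "complex \<Rightarrow> complex \<Rightarrow> complex \<Rightarrow> complex \<Rightarrow> cp1 \<Rightarrow> cp1" where
  "moebius a b c d x = ratio (a * num x + b * den x) (c * num x + d * den x)"

definition homography :: "(cp1 \<Rightarrow> cp1) \<Rightarrow> bool" where
  "homography f \<longleftrightarrow> (\<exists>a b c d. a * d \<noteq> b * c \<and> f = moebius a b c d)"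

lemma homographyE:
  assumes "homography f"
  obtains a b c d where "a * d \<noteq> b * c" "f = moebius a b c d"
  using assms by (auto simp: homography_def)

lemma linear_nonzero:
  fixes a b c d :: complex
  assumes "a * d \<noteq> b * c" "p \<noteq> 0 \<or> q \<noteq> 0"
  shows "a * p + b * q \<noteq> 0 \<or> c * p + d * q \<noteq> 0"
proof (rule ccontr)
  assume "\<not> ?thesis"
  hence "a * p + b * q = 0" "c * p + d * q = 0" by auto
  hence "(a * d - b * c) * p = 0" "(a * d - b * c) * q = 0" by algebra+
  thus False using assms by simp
qed

lemma moebius_ratio:
  assumes "p \<noteq> 0 \<or> q \<noteq> 0"
  shows "moebius a b c d (ratio p q) = ratio (a * p + b * q) (c * p + d * q)"
proof -
  obtain k where k: "k \<noteq> 0" "p = k * num (ratio p q)" "q = k * den (ratio p q)"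
    by (rule ratio_coordsE[OF assms])
  have "a * p + b * q = k * (a * num (ratio p q) + b * den (ratio p q))"
       "c * p + d * q = k * (c * num (ratio p q) + d * den (ratio p q))"
    using k(2,3) by algebra+
  thus ?thesis by (simp add: moebius_def ratio_scale[OF k(1)])
qed

lemma moebius_comp:
  assumes "a' * d' \<noteq> b' * c'"
  shows "moebius a b c d (moebius a' b' c' d' x) =
    moebius (a * a' + b * c') (a * b' + b * d') (c * a' + d * c') (c * b' + d * d') x"
  unfolding moebius_def[of a' b'] moebius_ratio[OF linear_nonzero[OF assms num_den_nonzero]]
  by (simp add: moebius_def algebra_simps)

lemma homography_comp:
  assumes "homography f" "homography g"
  shows "homography (f \<circ> g)"
proof -
  obtain a b c d where f: "a * d \<noteq> b * c" "f = moebius a b c d"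
    using assms(1) by (rule homographyE)
  obtain a' b' c' d' where g: "a' * d' \<noteq> b' * c'" "g = moebius a' b' c' d'"
    using assms(2) by (rule homographyE)
  have "(a * a' + b * c') * (c * b' + d * d') - (a * b' + b * d') * (c * a' + d * c')
      = (a * d - b * c) * (a' * d' - b' * c')"
    by algebra
  also have "\<dots> \<noteq> 0" using f(1) g(1) by simp
  finally have "(a * a' + b * c') * (c * b' + d * d') \<noteq> (a * b' + b * d') * (c * a' + d * c')"
    by simp
  thus ?thesis
    unfolding homography_def f(2) g(2) fun_eq_iff comp_def moebius_comp[OF g(1)] by blast
qed

lemma moebius_id: "k \<noteq> 0 \<Longrightarrow> moebius k 0 0 k = id"
  by (auto simp: moebius_def ratio_scale fun_eq_iff)

lemma homography_id: "homography id"
  unfolding homography_def by (rule exI[of _ 1], rule exI[of _ 0], rule exI[of _ 0], rule exI[of _ 1])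
    (simp add: moebius_id)

lemma homography_inverse:
  assumes "homography f"
  obtains g where "homography g" "g \<circ> f = id" "f \<circ> g = id"
proof -
  obtain a b c d where f: "a * d \<noteq> b * c" "f = moebius a b c d"
    using assms by (rule homographyE)
  define g where "g = moebius d (- b) (- c) a"
  have det: "d * a \<noteq> (- b) * (- c)" using f(1) by (simp add: mult_ac)
  have nz: "a * d - b * c \<noteq> 0" using f(1) by simp
  have "g (f x) = x" "f (g x) = x" for x
    unfolding g_def f(2) moebius_comp[OF f(1)] moebius_comp[OF det]
    using moebius_id[OF nz] by (simp_all add: algebra_simps)
  moreover have "homography g" unfolding homography_def g_def using det by blast
  ultimately show ?thesis using that by (auto simp: fun_eq_iff)
qed

lemma bij_homography: "homography f \<Longrightarrow> bij f"
  using homography_inverse o_bij by metis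

lemma homography_inv: "homography f \<Longrightarrow> homography (inv f)"
  using homography_inverse inv_unique_comp by metis

lemma regular_homography:
  assumes "homography f" shows "regular_cp1 f"
proof -
  obtain a b c d where f: "a * d \<noteq> b * c" "f = moebius a b c d"
    using assms by (rule homographyE)
  show ?thesis unfolding regular_cp1_def
  proof (rule exI[of _ 1], rule exI[of _ "[:b, a:]"], rule exI[of _ "[:d, c:]"], intro conjI allI)
    fix x
    show "\<not> (bform 1 [:b, a:] x = 0 \<and> bform 1 [:d, c:] x = 0)"
      using linear_nonzero[OF f(1) num_den_nonzero[of x]] by (simp add: bform_def add.commute)
    show "f x = ratio (bform 1 [:b, a:] x) (bform 1 [:d, c:] x)"
      by (simp add: f(2) moebius_def bform_def add.commute)
  qed simp_all
qed

section \<open>Quotients of the projective line by a sign change\<close>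

lemma bform_diff_smult:
  "bform d (smult k p - smult l q) x = k * bform d p x - l * bform d q x"
  by (simp add: bform_def sum_subtractf sum_distrib_left algebra_simps)

lemma bform_Fin: "degree p \<le> d \<Longrightarrow> bform d p (Fin z) = poly p z"
  unfolding bform_def poly_altdef
  by (rule sum.mono_neutral_cong_right) (auto simp: coeff_eq_0)

lemma bform_Inf: "bform d p Inf = coeff p d"
proof -
  have "bform d p Inf = (\<Sum>i\<le>d. if i = d then coeff p i else 0)"
    unfolding bform_def by (intro sum.cong) auto
  thus ?thesis by simp
qed

lemma degree_0_if_no_root:
  fixes p :: "complex poly"
  assumes "\<And>z. poly p z \<noteq> 0"
  shows "degree p = 0"
  using assms fundamental_theorem_of_algebra constant_degree by blast

text \<open>Over \<open>\<complex>\<close> a binary form without zeros outside a given point is a constant multiple of a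
power of the linear form of that point.\<close>
lemma bform_zero_only_at_Inf:
  assumes "degree p \<le> d" "\<And>z. bform d p (Fin z) \<noteq> 0"
  obtains k where "k \<noteq> 0" "\<And>x. bform d p x = k * den x ^ d"
proof -
  have "degree p = 0"
    using assms by (intro degree_0_if_no_root) (simp add: bform_Fin)
  then obtain k where p: "p = [:k:]" by (auto elim: degree_eq_zeroE)
  have "bform d p x = k * den x ^ d" for x
  proof -
    have "bform d p x = (\<Sum>i\<le>d. if i = 0 then k * den x ^ d else 0)"
      unfolding bform_def p by (intro sum.cong) (auto simp: coeff_pCons split: nat.split)
    thus ?thesis by simp
  qed
  moreover from this have "k \<noteq> 0" using assms(2)[of 0] by simp
  ultimately show ?thesis using that by blast
qed

lemma bform_zero_only_at_0:
  assumes "degree p \<le> d" "\<And>x. bform d p x = 0 \<longleftrightarrow> x = Fin 0"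
  obtains k where "k \<noteq> 0" "\<And>x. bform d p x = k * num x ^ d"
proof -
  have lead: "coeff p d \<noteq> 0" using assms(2)[of Inf] by (simp add: bform_Inf)
  hence "p \<noteq> 0" by auto
  then obtain q where q: "p = [:-0, 1:] ^ order 0 p * q" "\<not> [:-0, 1:] dvd q"
    using order_decomp by blast
  have "poly q z \<noteq> 0" for z
  proof (cases "z = 0")
    case True
    thus ?thesis using q(2) by (simp add: poly_eq_0_iff_dvd)
  next
    case False
    hence "poly p z \<noteq> 0" using assms(2)[of "Fin z"] by (simp add: bform_Fin assms(1))
    thus ?thesis by (subst (asm) q(1)) auto
  qed
  hence "degree q = 0" by (rule degree_0_if_no_root)
  then obtain k where "q = [:k:]" by (auto elim: degree_eq_zeroE)
  hence p: "p = monom k (order 0 p)" using q(1) by (simp add: monom_altdef)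
  have "coeff (monom k (order 0 p)) d \<noteq> 0" using lead by (subst p[symmetric])
  hence "order 0 p = d" "k \<noteq> 0" by (auto split: if_splits)
  have "bform d p x = k * num x ^ d" for x
  proof -
    have "bform d p x = (\<Sum>i\<le>d. if i = d then k * num x ^ d else 0)"
      unfolding bform_def by (subst p, intro sum.cong) (auto simp: \<open>order 0 p = d\<close>)
    thus ?thesis by simp
  qed
  with \<open>k \<noteq> 0\<close> show ?thesis using that by blast
qed

lemma cp1_neg_neg [simp]: "cp1_neg (cp1_neg x) = x"
  by (cases x) auto

lemma cp1_square_eq_iff: "cp1_square x = cp1_square y \<longleftrightarrow> y = x \<or> y = cp1_neg x"
  by (cases x; cases y) (auto simp: power2_eq_iff)

lemma cp1_square_ratio: "cp1_square x = ratio (num x ^ 2) (den x ^ 2)"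
  by (cases x) (auto simp: ratio_def)

text \<open>Let \<open>p/q\<close> represent \<open>g\<close> by forms of degree \<open>d\<close>. The fibres over \<open>g 0\<close> and \<open>g \<infinity>\<close> are the single
points \<open>0\<close> and \<open>\<infinity>\<close>, so the two combinations of \<open>p\<close> and \<open>q\<close> that cut out these fibres are constant
multiples of \<open>x1^d\<close> and \<open>x0^d\<close>. Solving for \<open>p\<close> and \<open>q\<close> exhibits \<open>g\<close> as a homography applied to
\<open>x^d\<close>, and \<open>d = 2\<close> because the fibre through \<open>1\<close> consists of the \<open>d\<close>-th roots of unity as well
as of \<open>1\<close> and \<open>-1\<close>.\<close>
lemma regular_even_quotient:
  assumes "regular_cp1 g"
    and fibre: "\<And>x y. g x = g y \<longleftrightarrow> y = x \<or> y = cp1_neg x"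
  obtains S where "homography S" "g = S \<circ> cp1_square"
proof -
  obtain d p q where deg: "degree p \<le> d" "degree q \<le> d"
    and nz: "\<And>x. bform d p x \<noteq> 0 \<or> bform d q x \<noteq> 0"
    and g: "\<And>x. g x = ratio (bform d p x) (bform d q x)"
    using assms(1) unfolding regular_cp1_def by blast
  define a where "a = g (Fin 0)"
  define b where "b = g Inf"
  have zero: "bform d (smult (den y) p - smult (num y) q) x = 0 \<longleftrightarrow> g x = y" for x y
    unfolding bform_diff_smult g ratio_eq_iff[OF nz] by (auto simp: mult_ac)
  have deg': "degree (smult k p - smult l q) \<le> d" for k l
    using deg by (intro degree_diff_le) (auto intro: order_trans[OF degree_smult_le])
  obtain k where k: "k \<noteq> 0" "\<And>x. den a * bform d p x - num a * bform d q x = k * num x ^ d"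
  proof (rule bform_zero_only_at_0[OF deg', of "den a" "num a"])
    fix x show "bform d (smult (den a) p - smult (num a) q) x = 0 \<longleftrightarrow> x = Fin 0"
      unfolding zero a_def using fibre[of "Fin 0" x] by (auto simp: eq_commute)
  qed (use that in \<open>auto simp: bform_diff_smult\<close>)
  obtain l where l: "l \<noteq> 0" "\<And>x. den b * bform d p x - num b * bform d q x = l * den x ^ d"
  proof (rule bform_zero_only_at_Inf[OF deg', of "den b" "num b"])
    fix z show "bform d (smult (den b) p - smult (num b) q) (Fin z) \<noteq> 0"
      unfolding zero b_def using fibre[of Inf "Fin z"] by (auto simp: eq_commute)
  qed (use that in \<open>auto simp: bform_diff_smult\<close>)
  have "a \<noteq> b" unfolding a_def b_def using fibre[of "Fin 0" Inf] by simp
  define \<Delta> where "\<Delta> = num a * den b - den a * num b"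
  have \<Delta>: "\<Delta> \<noteq> 0"
    unfolding \<Delta>_def using \<open>a \<noteq> b\<close> by (cases a; cases b) auto
  \<comment> \<open>Cramer's rule recovers the forms \<open>p\<close> and \<open>q\<close>, up to the factor \<open>\<Delta>\<close>.\<close>
  define S where "S = moebius (- (num b * k)) (num a * l) (- (den b * k)) (den a * l)"
  have det: "- (num b * k) * (den a * l) \<noteq> (num a * l) * (- (den b * k))"
  proof -
    have "- (num b * k) * (den a * l) - (num a * l) * (- (den b * k)) = k * l * \<Delta>"
      unfolding \<Delta>_def by algebra
    also have "\<dots> \<noteq> 0" using k(1) l(1) \<Delta> by simp
    finally show ?thesis by (metis right_minus_eq)
  qed
  have g_pow: "g x = S (ratio (num x ^ d) (den x ^ d))" for x
  proof -
    have pq: "\<Delta> * bform d p x = - (num b * k) * num x ^ d + (num a * l) * den x ^ d"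
         "\<Delta> * bform d q x = - (den b * k) * num x ^ d + (den a * l) * den x ^ d"
    proof -
      have "\<Delta> * bform d p x = num a * (den b * bform d p x - num b * bform d q x)
                          - num b * (den a * bform d p x - num a * bform d q x)"
           "\<Delta> * bform d q x = den a * (den b * bform d p x - num b * bform d q x)
                          - den b * (den a * bform d p x - num a * bform d q x)"
        by (simp_all add: \<Delta>_def algebra_simps)
      thus "\<Delta> * bform d p x = - (num b * k) * num x ^ d + (num a * l) * den x ^ d"
           "\<Delta> * bform d q x = - (den b * k) * num x ^ d + (den a * l) * den x ^ d"
        unfolding k(2) l(2) by simp_all
    qed
    have nz_pow: "num x ^ d \<noteq> 0 \<or> den x ^ d \<noteq> 0" using num_den_nonzero[of x] by auto
    have "g x = ratio (\<Delta> * bform d p x) (\<Delta> * bform d q x)"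
      unfolding g by (rule ratio_scale[OF \<Delta>, symmetric])
    also have "\<dots> = S (ratio (num x ^ d) (den x ^ d))"
      unfolding S_def pq by (rule moebius_ratio[OF nz_pow, symmetric])
    finally show ?thesis .
  qed
  have S: "homography S" unfolding homography_def S_def using det by blast
  have pow_iff: "g (Fin 1) = g (Fin z) \<longleftrightarrow> z ^ d = 1" for z
    unfolding g_pow using bij_homography[OF S] by (auto simp: bij_def inj_eq ratio_def)
  have "d \<noteq> 0"
    using pow_iff[of 0] fibre[of "Fin 1" "Fin 0"] by (intro notI) auto
  have "{z::complex. z ^ d = 1} = {1, - 1}"
    using pow_iff fibre[of "Fin 1" "Fin _"] by auto
  hence "d = 2"
    using card_roots_unity_eq[of d] \<open>d \<noteq> 0\<close> by simp
  have "g = S \<circ> cp1_square"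
    unfolding fun_eq_iff comp_def g_pow cp1_square_ratio \<open>d = 2\<close> by simp
  with S show ?thesis using that by blast
qed

section \<open>Addition in projective coordinates, before and after squaring\<close>

lemma form_zeros_linear:
  assumes "a \<noteq> 0 \<or> b \<noteq> 0"
  shows "form_zeros 1 [:- a, b:] = {#ratio a b#}"
proof (cases "b = 0")
  case True
  thus ?thesis using assms by (simp add: form_zeros_def ratio_def)
next
  case False
  have "proots [:- a, b:] = proots (smult b [:- (a / b), 1:])" using False by simp
  also have "\<dots> = {#a / b#}" using False by (simp del: smult_pCons)
  finally have "proots [:- a, b:] = {#a / b#}" .
  thus ?thesis using False by (simp add: form_zeros_def ratio_def)
qed

lemma form_zeros_smult: "k \<noteq> 0 \<Longrightarrow> form_zeros n (smult k p) = form_zeros n p"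
  by (simp add: form_zeros_def)

lemma form_zeros_mult:
  assumes "p \<noteq> 0" "q \<noteq> 0" "degree p \<le> m" "degree q \<le> n"
  shows "form_zeros (m + n) (p * q) = form_zeros m p + form_zeros n q"
proof -
  have "m + n - degree (p * q) = (m - degree p) + (n - degree q)"
    using assms by (simp add: degree_mult_eq)
  thus ?thesis
    using assms by (simp add: form_zeros_def proots_mult multiset_eq_iff)
qed

text \<open>The polynomial \<open>p(x) q(y) r(z)\<close>. Operations written as sums of such products have forms that can be
computed at infinite points as easily as at finite ones.\<close>
definition tensor :: "complex poly \<Rightarrow> complex poly \<Rightarrow> complex poly \<Rightarrow> poly3" where
  "tensor p q r = map_poly (\<lambda>a. map_poly (\<lambda>b. smult (a * b) r) q) p"

lemma coeff_tensor: "coeff (coeff (tensor p q r) j) k = smult (coeff p j * coeff q k) r"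
proof -
  have "map_poly (\<lambda>b. 0) q = (0 :: complex poly poly)"
    by (simp add: poly_eq_iff coeff_map_poly)
  thus ?thesis by (simp add: tensor_def coeff_map_poly)
qed

lemma form_at_tensor:
  "form_at d e (tensor p q r) x y = smult (bform d p x * bform e q y) r"
proof -
  have "form_at d e (tensor p q r) x y = (\<Sum>j\<le>d. \<Sum>k\<le>e.
      smult ((coeff p j * num x ^ j * den x ^ (d - j)) * (coeff q k * num y ^ k * den y ^ (e - k))) r)"
    unfolding form_at_def coeff_tensor by (intro sum.cong refl) (simp add: mult_ac)
  also have "\<dots> = smult (bform d p x * bform e q y) r"
    unfolding bform_def sum_product smult_sum ..
  finally show ?thesis .
qed

lemma form_at_add: "form_at d e (P + Q) x y = form_at d e P x y + form_at d e Q x y"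
  by (simp add: form_at_def smult_add_right sum.distrib)

lemma degrees_le_tensor:
  assumes "degree p \<le> d" "degree q \<le> e" "degree r \<le> n"
  shows "degrees_le n d e (tensor p q r)"
  unfolding degrees_le_def coeff3_def coeff_tensor
  using assms by (auto intro: order_trans[OF le_degree])

lemma degrees_le_add:
  "degrees_le n d e P \<Longrightarrow> degrees_le n d e Q \<Longrightarrow> degrees_le n d e (P + Q)"
  unfolding degrees_le_def
proof (intro allI impI)
  fix i j k
  assume P: "\<forall>i j k. coeff3 P i j k \<noteq> 0 \<longrightarrow> i \<le> n \<and> j \<le> d \<and> k \<le> e"
    and Q: "\<forall>i j k. coeff3 Q i j k \<noteq> 0 \<longrightarrow> i \<le> n \<and> j \<le> d \<and> k \<le> e"
    and "coeff3 (P + Q) i j k \<noteq> 0"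
  hence "coeff3 P i j k \<noteq> 0 \<or> coeff3 Q i j k \<noteq> 0"
    by (auto simp: coeff3_def)
  with P Q show "i \<le> n \<and> j \<le> d \<and> k \<le> e" by blast
qed

text \<open>Write \<open>S = moebius a b c d\<close> and recover \<open>X = S\<inverse> x\<close> homogeneously as \<open>X1 = d x - b\<close>,
\<open>X0 = a - c x\<close>, and \<open>Y = S\<inverse> y\<close> in the same way. Since \<open>X + Y = s / w\<close> with
\<open>s = X1 Y0 + X0 Y1\<close> and \<open>w = X0 Y0\<close>, the point \<open>z = S (X + Y)\<close> is the zero of
\<open>s (c z - a) + w (d z - b)\<close>, the polynomial below.\<close>
definition sum_poly :: "complex \<Rightarrow> complex \<Rightarrow> complex \<Rightarrow> complex \<Rightarrow> poly3" where
  "sum_poly a b c d =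
     tensor [:- b, d:] [:a, - c:] [:- a, c:] + tensor [:a, - c:] [:- b, d:] [:- a, c:] +
     tensor [:a, - c:] [:a, - c:] [:- b, d:]"

text \<open>Now \<open>x = S (u\<^sup>2)\<close> and \<open>y = S (v\<^sup>2)\<close>, so that \<open>X\<close> and \<open>Y\<close> are the squares \<open>u\<^sup>2\<close> and \<open>v\<^sup>2\<close>. The zeros
wanted are \<open>S ((u + v)\<^sup>2)\<close> and \<open>S ((u - v)\<^sup>2)\<close>, that is, those of the product of
\<open>s\<^sup>2 (c z - a) + w\<^sup>2 (d z - b)\<close> and \<open>t\<^sup>2 (c z - a) + w\<^sup>2 (d z - b)\<close> with \<open>s, t = u1 v0 \<plusminus> u0 v1\<close>
and \<open>w = u0 v0\<close>. It depends on \<open>u\<close> and \<open>v\<close> only through their squares, as \<open>s\<^sup>2 t\<^sup>2 = (X1 Y0 - X0 Y1)\<^sup>2\<close>,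
\<open>s\<^sup>2 + t\<^sup>2 = 2 (X1 Y0 + X0 Y1)\<close> and \<open>w\<^sup>2 = X0 Y0\<close>. For \<open>S = id\<close> it is \<open>p\<^sub>2(z; x, y)\<close>.\<close>
definition square_poly :: "complex \<Rightarrow> complex \<Rightarrow> complex \<Rightarrow> complex \<Rightarrow> poly3" where
  "square_poly a b c d = (let X1 = [:- b, d:]; X0 = [:a, - c:]; R = [:- a, c:]; T = [:- b, d:] in
     tensor (X1 * X1) (X0 * X0) (R * R) + tensor (X0 * X0) (X1 * X1) (R * R) +
     tensor (X1 * X0) (X1 * X0) (smult (- 2) (R * R)) +
     tensor (X1 * X0) (X0 * X0) (smult 2 (R * T)) + tensor (X0 * X0) (X1 * X0) (smult 2 (R * T)) +
     tensor (X0 * X0) (X0 * X0) (T * T))"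

lemma degrees_le_sum_poly: "degrees_le 1 1 1 (sum_poly a b c d)"
  unfolding sum_poly_def by (intro degrees_le_add degrees_le_tensor) simp_all

lemma degrees_le_square_poly: "degrees_le 2 2 2 (square_poly a b c d)"
  unfolding square_poly_def Let_def
  by (intro degrees_le_add degrees_le_tensor) (simp_all add: degree_pCons_eq_if)

lemma bform_1: "bform 1 [:b, a:] x = a * num x + b * den x"
  by (simp add: bform_def)

lemma bform_mult_linear: "bform 2 ([:b, a:] * [:b', a':]) x = bform 1 [:b, a:] x * bform 1 [:b', a':] x"
  by (simp add: bform_def eval_nat_numeral algebra_simps)

text \<open>The inverse matrix up to its determinant recovers homogeneous coordinates, up to a common factor,
which does not affect the zeros of a form.\<close>
lemma inverse_coordsE:
  assumes "a * d \<noteq> b * c" "p \<noteq> 0 \<or> q \<noteq> 0" and x: "x = ratio (a * p + b * q) (c * p + d * q)"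
  obtains k where "k \<noteq> 0" "bform 1 [:- b, d:] x = k * p" "bform 1 [:a, - c:] x = k * q"
proof -
  obtain l where l: "l \<noteq> 0" "a * p + b * q = l * num x" "c * p + d * q = l * den x"
    unfolding x by (rule ratio_coordsE[OF linear_nonzero[OF assms(1,2)]])
  have "l * bform 1 [:- b, d:] x = (a * d - b * c) * p"
       "l * bform 1 [:a, - c:] x = (a * d - b * c) * q"
    unfolding bform_1 using l(2,3) by algebra+
  hence "bform 1 [:- b, d:] x = (a * d - b * c) / l * p"
        "bform 1 [:a, - c:] x = (a * d - b * c) / l * q"
    using l(1) by (simp_all add: field_simps)
  moreover have "(a * d - b * c) / l \<noteq> 0" using assms(1) l(1) by simp
  ultimately show ?thesis using that by blast
qed

lemma form_at_sum_poly:
  assumes "bform 1 [:- b, d:] x = k * p" "bform 1 [:a, - c:] x = k * q"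
    "bform 1 [:- b, d:] y = l * p'" "bform 1 [:a, - c:] y = l * q'"
  shows "form_at 1 1 (sum_poly a b c d) x y =
    smult (k * l) [:- (a * (p * q' + q * p') + b * (q * q')), c * (p * q' + q * p') + d * (q * q'):]"
  unfolding sum_poly_def form_at_add form_at_tensor assms by (simp add: algebra_simps)

lemma form_at_square_poly:
  assumes "bform 1 [:- b, d:] x = k * p\<^sup>2" "bform 1 [:a, - c:] x = k * q\<^sup>2"
    "bform 1 [:- b, d:] y = l * p'\<^sup>2" "bform 1 [:a, - c:] y = l * q'\<^sup>2"
  shows "form_at 2 2 (square_poly a b c d) x y = smult (k\<^sup>2 * l\<^sup>2)
    ([:- (a * (p * q' + q * p')\<^sup>2 + b * (q * q')\<^sup>2), c * (p * q' + q * p')\<^sup>2 + d * (q * q')\<^sup>2:] *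
     [:- (a * (p * q' - q * p')\<^sup>2 + b * (q * q')\<^sup>2), c * (p * q' - q * p')\<^sup>2 + d * (q * q')\<^sup>2:])"
proof -
  have "poly (form_at 2 2 (square_poly a b c d) x y) z = poly (smult (k\<^sup>2 * l\<^sup>2)
    ([:- (a * (p * q' + q * p')\<^sup>2 + b * (q * q')\<^sup>2), c * (p * q' + q * p')\<^sup>2 + d * (q * q')\<^sup>2:] *
     [:- (a * (p * q' - q * p')\<^sup>2 + b * (q * q')\<^sup>2), c * (p * q' - q * p')\<^sup>2 + d * (q * q')\<^sup>2:])) z" for z
    unfolding square_poly_def Let_def form_at_add form_at_tensor bform_mult_linear assms
    by (simp del: mult_pCons_left mult_pCons_right) algebra
  thus ?thesis by (intro poly_eq_poly_eq_iff[THEN iffD1] ext)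
qed

lemma additive_mul [simp]:
  "mul additive_monoid (Fin a) (Fin b) = Some {#Fin (a + b)#}"
  "mul additive_monoid (Fin a) Inf = Some {#Inf#}"
  "mul additive_monoid Inf (Fin b) = Some {#Inf#}"
  "mul additive_monoid Inf Inf = None"
  by (simp_all add: additive_monoid_def ratio_def)

text \<open>The two values \<open>u + v\<close> and \<open>u - v\<close> of the additive monoid, i.e. its coset words for \<open>z \<mapsto> - z\<close>.\<close>
fun sum_diff :: "cp1 \<Rightarrow> cp1 \<Rightarrow> cp1 multiset option" where
  "sum_diff (Fin a) (Fin b) = Some {#Fin (a + b), Fin (a - b)#}"
| "sum_diff Inf Inf = None"
| "sum_diff _ _ = Some {#Inf, Inf#}"

lemma linear_poly_nonzero:
  fixes a b :: complex
  shows "a \<noteq> 0 \<or> b \<noteq> 0 \<Longrightarrow> [:- a, b:] \<noteq> 0"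
  by auto

lemma form_op_sum_poly:
  assumes "a * d \<noteq> b * c"
  defines "S \<equiv> moebius a b c d"
  shows "form_op 1 1 1 (sum_poly a b c d) (S x) (S y) =
           map_option (image_mset S) (mul additive_monoid x y)"
proof -
  define s where "s = num x * den y + den x * num y"
  define w where "w = den x * den y"
  have Sx: "S x = ratio (a * num x + b * den x) (c * num x + d * den x)" for x
    by (simp add: S_def moebius_def)
  obtain k where k: "k \<noteq> 0"
    "bform 1 [:- b, d:] (S x) = k * num x" "bform 1 [:a, - c:] (S x) = k * den x"
    by (rule inverse_coordsE[OF assms(1) num_den_nonzero Sx])
  obtain l where l: "l \<noteq> 0"
    "bform 1 [:- b, d:] (S y) = l * num y" "bform 1 [:a, - c:] (S y) = l * den y"
    by (rule inverse_coordsE[OF assms(1) num_den_nonzero Sx])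
  note form = form_at_sum_poly[OF k(2,3) l(2,3), folded s_def w_def]
  show ?thesis
  proof (cases "s = 0 \<and> w = 0")
    case True
    hence "form_at 1 1 (sum_poly a b c d) (S x) (S y) = 0" unfolding form by simp
    moreover have "mul additive_monoid x y = None"
      using True unfolding additive_monoid_def s_def w_def by simp
    ultimately show ?thesis by (simp add: form_op_def)
  next
    case False
    hence nz: "a * s + b * w \<noteq> 0 \<or> c * s + d * w \<noteq> 0"
      by (intro linear_nonzero[OF assms(1)]) auto
    have "form_at 1 1 (sum_poly a b c d) (S x) (S y) \<noteq> 0"
      unfolding form using k(1) l(1) linear_poly_nonzero[OF nz] by (simp del: pCons_eq_0_iff smult_pCons)
    moreover have "mul additive_monoid x y = Some {#ratio s w#}"
      using False unfolding additive_monoid_def s_def w_def by auto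
    moreover have "S (ratio s w) = ratio (a * s + b * w) (c * s + d * w)"
      unfolding S_def using False by (intro moebius_ratio) auto
    moreover have "form_zeros 1 (form_at 1 1 (sum_poly a b c d) (S x) (S y))
        = {#ratio (a * s + b * w) (c * s + d * w)#}"
      unfolding form using k(1) l(1) form_zeros_linear[OF nz] by (subst form_zeros_smult) auto
    ultimately show ?thesis by (simp add: form_op_def)
  qed
qed

lemma sum_diff_ratio:
  "sum_diff x y =
     (let s = num x * den y + den x * num y; t = num x * den y - den x * num y; w = den x * den y
      in if s = 0 \<and> w = 0 then None else Some {#ratio s w, ratio t w#})"
  by (cases x; cases y) (auto simp: ratio_def)

lemma form_op_square_poly:
  assumes "a * d \<noteq> b * c"
  defines "S \<equiv> moebius a b c d"
  shows "form_op 2 2 2 (square_poly a b c d) (S (cp1_square x)) (S (cp1_square y)) =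
           map_option (image_mset (S \<circ> cp1_square)) (sum_diff x y)"
proof -
  define s where "s = num x * den y + den x * num y"
  define t where "t = num x * den y - den x * num y"
  define w where "w = den x * den y"
  have S_sq: "S (cp1_square (ratio p q)) = ratio (a * p\<^sup>2 + b * q\<^sup>2) (c * p\<^sup>2 + d * q\<^sup>2)"
    if "p \<noteq> 0 \<or> q \<noteq> 0" for p q
  proof -
    have "cp1_square (ratio p q) = ratio (p\<^sup>2) (q\<^sup>2)"
      by (simp add: ratio_def power_divide)
    thus ?thesis
      unfolding S_def using that by (simp add: moebius_ratio)
  qed
  have S_sq': "S (cp1_square z) = ratio (a * (num z)\<^sup>2 + b * (den z)\<^sup>2) (c * (num z)\<^sup>2 + d * (den z)\<^sup>2)" for z
    using S_sq[OF num_den_nonzero[of z]] by simp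
  have nz2: "(num z)\<^sup>2 \<noteq> 0 \<or> (den z)\<^sup>2 \<noteq> 0" for z
    using num_den_nonzero[of z] by simp
  obtain k where k: "k \<noteq> 0"
    "bform 1 [:- b, d:] (S (cp1_square x)) = k * (num x)\<^sup>2"
    "bform 1 [:a, - c:] (S (cp1_square x)) = k * (den x)\<^sup>2"
    by (rule inverse_coordsE[OF assms(1) nz2 S_sq'])
  obtain l where l: "l \<noteq> 0"
    "bform 1 [:- b, d:] (S (cp1_square y)) = l * (num y)\<^sup>2"
    "bform 1 [:a, - c:] (S (cp1_square y)) = l * (den y)\<^sup>2"
    by (rule inverse_coordsE[OF assms(1) nz2 S_sq'])
  note form = form_at_square_poly[OF k(2,3) l(2,3), folded s_def t_def w_def]
  have st: "s = 0 \<and> w = 0 \<longleftrightarrow> t = 0 \<and> w = 0"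
    unfolding s_def t_def w_def by (cases x; cases y) auto
  have sd: "sum_diff x y = (if s = 0 \<and> w = 0 then None else Some {#ratio s w, ratio t w#})"
    unfolding sum_diff_ratio s_def t_def w_def Let_def ..
  show ?thesis
  proof (cases "s = 0 \<and> w = 0")
    case True
    hence "form_at 2 2 (square_poly a b c d) (S (cp1_square x)) (S (cp1_square y)) = 0"
      unfolding form by simp
    with True show ?thesis by (simp add: form_op_def sd)
  next
    case False
    hence "s\<^sup>2 \<noteq> 0 \<or> w\<^sup>2 \<noteq> 0" "t\<^sup>2 \<noteq> 0 \<or> w\<^sup>2 \<noteq> 0" using st by auto
    hence nz: "a * s\<^sup>2 + b * w\<^sup>2 \<noteq> 0 \<or> c * s\<^sup>2 + d * w\<^sup>2 \<noteq> 0"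
              "a * t\<^sup>2 + b * w\<^sup>2 \<noteq> 0 \<or> c * t\<^sup>2 + d * w\<^sup>2 \<noteq> 0"
      by (intro linear_nonzero[OF assms(1)]; simp)+
    define p where "p = [:- (a * s\<^sup>2 + b * w\<^sup>2), c * s\<^sup>2 + d * w\<^sup>2:]"
    define q where "q = [:- (a * t\<^sup>2 + b * w\<^sup>2), c * t\<^sup>2 + d * w\<^sup>2:]"
    have form': "form_at 2 2 (square_poly a b c d) (S (cp1_square x)) (S (cp1_square y)) =
        smult (k\<^sup>2 * l\<^sup>2) (p * q)"
      unfolding form p_def q_def ..
    have pq: "p \<noteq> 0" "q \<noteq> 0" 
      unfolding p_def q_def by (rule linear_poly_nonzero[OF nz(1)], rule linear_poly_nonzero[OF nz(2)])
    have "form_zeros 2 (smult (k\<^sup>2 * l\<^sup>2) (p * q)) = form_zeros (1 + 1) (p * q)"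
      using k(1) l(1) by (simp add: form_zeros_smult numeral_2_eq_2)
    also have "\<dots> = form_zeros 1 p + form_zeros 1 q"
      using pq by (intro form_zeros_mult) (simp_all add: p_def q_def)
    also have "\<dots> = {#S (cp1_square (ratio s w)), S (cp1_square (ratio t w))#}"
      unfolding p_def q_def form_zeros_linear[OF nz(1)] form_zeros_linear[OF nz(2)]
      using False st by (subst (1 2) S_sq) auto
    finally show ?thesis
      using False pq k(1) l(1) unfolding form_op_def form' sd by simp
  qed
qed

section \<open>Two-valued monoids obtained by squaring\<close>

lemma mbind_single [simp]: "mbind {#t#} f = f t"
  by (auto simp: mbind_def)

lemma mbind_pair: "mbind {#s, t#} f = Option.bind (f s) (\<lambda>A. map_option ((+) A) (f t))"
  by (cases "f s"; cases "f t") (auto simp: mbind_def)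

definition square_monoid :: "complex \<Rightarrow> complex \<Rightarrow> complex \<Rightarrow> complex \<Rightarrow> cp1 nvmonoid" where
  "square_monoid a b c d = \<lparr>pts = UNIV, crd = id, mul = form_op 2 2 2 (square_poly a b c d),
     neu = moebius a b c d (Fin 0)\<rparr>"

lemma cp1_square_surj: "\<exists>y. x = cp1_square y"
proof (cases x)
  case (Fin z)
  thus ?thesis by (intro exI[of _ "Fin (csqrt z)"]) simp
qed (intro exI[of _ Inf], simp)

text \<open>Pulled back along \<open>\<pi> = S \<circ> square\<close>, which is onto, the product of \<open>\<pi> u\<close> and \<open>\<pi> v\<close> is
\<open>[\<pi> (u + v), \<pi> (u - v)]\<close>. Both bracketings of a triple product then give the same four values
\<open>\<pi> (u \<plusminus> v \<plusminus> w)\<close>, because \<open>\<pi>\<close> does not see an overall sign.\<close>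
lemma algebraic_square_monoid:
  assumes "a * d \<noteq> b * c"
  shows "algebraic_nvmonoid 2 (square_monoid a b c d)"
proof -
  define \<pi> where "\<pi> = moebius a b c d \<circ> cp1_square"
  define m where "m = form_op 2 2 2 (square_poly a b c d)"
  have m: "m (\<pi> x) (\<pi> y) = map_option (image_mset \<pi>) (sum_diff x y)" for x y
    using form_op_square_poly[OF assms, of x y] by (simp add: m_def \<pi>_def)
  have h: "homography (moebius a b c d)" using assms unfolding homography_def by blast
  have lift: "\<exists>y. x = \<pi> y" for x
    using bij_homography[OF h] cp1_square_surj unfolding \<pi>_def
    by (metis bij_is_surj comp_apply surj_def)
  have size: "size M = 2" if "m x y = Some M" for x y M
  proof -
    obtain u v where "x = \<pi> u" "y = \<pi> v" using lift by metis
    thus ?thesis using that m by (cases u; cases v) auto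
  qed
  have even: "\<pi> (Fin (- z)) = \<pi> (Fin z)" for z
    by (simp add: \<pi>_def)
  have neg: "\<pi> (Fin (z - w)) = \<pi> (Fin (w - z))" for z w
    using even[of "w - z"] by simp
  have "m (\<pi> (Fin 0)) (\<pi> (Fin 0)) \<noteq> None" unfolding m by simp
  hence "square_poly a b c d \<noteq> 0" by (auto simp: m_def form_op_def form_at_def)
  moreover have "Option.bind (m y z) (\<lambda>W. mbind W (\<lambda>t. m x t)) =
                 Option.bind (m x y) (\<lambda>W. mbind W (\<lambda>t. m t z))" for x y z
  proof -
    obtain u v w where "x = \<pi> u" "y = \<pi> v" "z = \<pi> w" using lift by metis
    thus ?thesis
      by (cases u; cases v; cases w) (simp_all add: m mbind_pair algebra_simps)
  qed
  moreover have "m x (\<pi> (Fin 0)) = Some {#x, x#} \<and> m (\<pi> (Fin 0)) x = Some {#x, x#}" for x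
  proof -
    obtain u where "x = \<pi> u" using lift by metis
    thus ?thesis by (cases u) (simp_all add: m even)
  qed
  moreover have "\<pi> (Fin 0) = moebius a b c d (Fin 0)" by (simp add: \<pi>_def)
  ultimately show ?thesis
    unfolding algebraic_nvmonoid_def square_monoid_def Sym_def
    using degrees_le_square_poly[of a b c d] size
    by (auto simp: m_def option.map_id0 multiset.map_id0 numeral_2_eq_2
        intro!: exI[of _ "Suc (Suc 0)"] exI[of _ "square_poly a b c d"])
qed

section \<open>Monoids that are additive in some coordinate\<close>

text \<open>A monoid with an involution \<open>h\<close> and a coordinate \<open>u\<close> in which the monoid is the additive one and
\<open>h\<close> is \<open>z \<mapsto> - z\<close>. The coordinate that defines its algebraic structure may differ from \<open>u\<close> by a
homography \<open>S\<close>: on the cubic this coordinate is the slope, while the additive one is its inverse.\<close>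
locale additive_chart =
  fixes M :: "'a nvmonoid" and h :: "'a \<Rightarrow> 'a" and u :: "'a \<Rightarrow> cp1" and S :: "cp1 \<Rightarrow> cp1"
  assumes bij_u: "bij_betw u (pts M) UNIV"
    and homography_S: "homography S"
    and crd_S: "p \<in> pts M \<Longrightarrow> crd M p = S (u p)"
    and neu_pts: "neu M \<in> pts M" and u_neu: "u (neu M) = Fin 0"
    and mul_pts: "\<lbrakk>p \<in> pts M; q \<in> pts M; mul M p q = Some m\<rbrakk> \<Longrightarrow> set_mset m \<subseteq> pts M"
    and mul_u: "\<lbrakk>p \<in> pts M; q \<in> pts M\<rbrakk> \<Longrightarrow>
      map_option (image_mset u) (mul M p q) = mul additive_monoid (u p) (u q)"
    and h_pts: "p \<in> pts M \<Longrightarrow> h p \<in> pts M"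
    and u_h: "p \<in> pts M \<Longrightarrow> u (h p) = cp1_neg (u p)"
    and h_h: "h (h p) = p"
begin

definition point :: "cp1 \<Rightarrow> 'a" where "point = inv_into (pts M) u"

lemma point_pts [simp]: "point x \<in> pts M"
  unfolding point_def using bij_u by (metis bij_betw_def inv_into_into UNIV_I)

lemma u_point [simp]: "u (point x) = x"
  unfolding point_def using bij_u by (metis bij_betw_def f_inv_into_f UNIV_I)

lemma point_u [simp]: "p \<in> pts M \<Longrightarrow> point (u p) = p"
  unfolding point_def using bij_u by (simp add: bij_betw_def)

lemma mul_point:
  assumes "p \<in> pts M" "q \<in> pts M"
  shows "mul M p q = map_option (image_mset point) (mul additive_monoid (u p) (u q))"
proof (cases "mul M p q")
  case (Some m)
  hence "image_mset (point \<circ> u) m = image_mset id m"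
    using mul_pts[OF assms] by (intro image_mset_cong) (auto simp: subset_iff)
  thus ?thesis using mul_u[OF assms, symmetric] Some by (simp add: multiset.map_comp)
qed (use mul_u[OF assms, symmetric] in simp)

lemma h_moves_point: "h (point (Fin 1)) \<noteq> point (Fin 1)"
proof
  assume "h (point (Fin 1)) = point (Fin 1)"
  hence "u (h (point (Fin 1))) = u (point (Fin 1))" by (rule arg_cong)
  thus False by (simp add: u_h)
qed

lemma h_neq_id: "h \<noteq> id"
  using h_moves_point by auto

lemma neu_point: "neu M = point (Fin 0)"
  using neu_pts u_neu point_u by metis

lemma algebraic: "algebraic_nvmonoid 1 M"
proof -
  obtain a b c d where det: "a * d \<noteq> b * c" and S: "S = moebius a b c d"
    using homography_S by (rule homographyE)
  have "bij_betw (S \<circ> u) (pts M) UNIV"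
    using bij_u bij_homography[OF homography_S] by (rule bij_betw_trans)
  hence "bij_betw (crd M) (pts M) UNIV"
    by (subst bij_betw_cong[where g = "S \<circ> u"]) (simp_all add: crd_S)
  moreover have "m \<in> Sym 1 (pts M)" if "p \<in> pts M" "q \<in> pts M" "mul M p q = Some m" for p q m
    using that by (cases "u p"; cases "u q") (auto simp: mul_point Sym_def)
  moreover have form: "map_option (image_mset (crd M)) (mul M p q) =
      form_op 1 1 1 (sum_poly a b c d) (crd M p) (crd M q)" if "p \<in> pts M" "q \<in> pts M" for p q
  proof -
    have "map_option (image_mset (crd M)) (mul M p q) =
        map_option (image_mset S) (mul additive_monoid (u p) (u q))"
      using that by (simp add: crd_S mul_point option.map_comp comp_def multiset.map_comp)
    also have "\<dots> = form_op 1 1 1 (sum_poly a b c d) (crd M p) (crd M q)"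
      using that by (simp only: crd_S S form_op_sum_poly[OF det])
    finally show ?thesis .
  qed
  moreover have "sum_poly a b c d \<noteq> 0"
    using form[OF neu_pts neu_pts]
    by (auto simp: mul_point neu_pts u_neu form_op_def form_at_def split: if_splits)
  moreover have "Option.bind (mul M q r) (\<lambda>W. mbind W (\<lambda>t. mul M p t)) =
        Option.bind (mul M p q) (\<lambda>W. mbind W (\<lambda>t. mul M t r))"
    if "p \<in> pts M" "q \<in> pts M" "r \<in> pts M" for p q r
    using that by (cases "u p"; cases "u q"; cases "u r") (simp_all add: mul_point add.assoc)
  moreover have "mul M p (neu M) = Some {#p#} \<and> mul M (neu M) p = Some {#p#}" if "p \<in> pts M" for p
    using that point_u[OF that] by (cases "u p") (auto simp: mul_point neu_pts u_neu)
  ultimately show ?thesis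
    unfolding algebraic_nvmonoid_def
    using neu_pts degrees_le_sum_poly[of a b c d] by fastforce
qed

text \<open>Changing the sign of the coordinate gives another chart of the same kind. Read between the two
charts, \<open>h\<close> is the identity, so it is an automorphism by the comparison of charts below.\<close>
lemma additive_chart_neg: "additive_chart M h (cp1_neg \<circ> u) (S \<circ> cp1_neg)"
proof
  have neg: "cp1_neg = moebius (- 1) 0 0 1"
  proof
    fix x show "cp1_neg x = moebius (- 1) 0 0 1 x"
      by (cases x) (simp_all add: moebius_def ratio_def)
  qed
  have "homography cp1_neg"
    unfolding homography_def neg
    by (rule exI[of _ "- 1"], rule exI[of _ 0], rule exI[of _ 0], rule exI[of _ 1]) simp
  thus "homography (S \<circ> cp1_neg)" using homography_S by (rule homography_comp[rotated])
  have "bij cp1_neg" by (rule o_bij[of cp1_neg]) auto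
  thus "bij_betw (cp1_neg \<circ> u) (pts M) UNIV" using bij_u bij_betw_trans by blast
  show "map_option (image_mset (cp1_neg \<circ> u)) (mul M p q) =
    mul additive_monoid ((cp1_neg \<circ> u) p) ((cp1_neg \<circ> u) q)" if "p \<in> pts M" "q \<in> pts M" for p q
    using that by (cases "u p"; cases "u q") (simp_all add: mul_point)
qed (use neu_pts u_neu mul_pts h_pts u_h h_h crd_S in auto)

end

text \<open>In the charts \<open>f\<close> is the identity, and the transition to the algebraic coordinates is a homography.\<close>
lemma nv_iso_charts:
  assumes M: "additive_chart M h u S" and N: "additive_chart N h' u' S'"
    and f: "\<And>p. p \<in> pts M \<Longrightarrow> f p \<in> pts N" "\<And>p. p \<in> pts M \<Longrightarrow> u' (f p) = u p"
  shows "nv_iso f M N"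
proof -
  interpret M: additive_chart M h u S by fact
  interpret N: additive_chart N h' u' S' by fact
  have f_eq: "f p = N.point (u p)" if "p \<in> pts M" for p
    using f[OF that] N.point_u by metis
  have bij: "bij_betw f (pts M) (pts N)"
    by (rule bij_betwI[of _ _ _ "M.point \<circ> u'"]) (auto simp: f_eq)
  have inv: "inv_into (pts M) f q = M.point (u' q)" if "q \<in> pts N" for q
    using bij that by (intro inv_into_f_eq) (auto simp: bij_betw_def f_eq)
  obtain T where T: "homography T" "T \<circ> S = id" "S \<circ> T = id"
    using homography_inverse[OF M.homography_S] .
  obtain T' where T': "homography T'" "T' \<circ> S' = id" "S' \<circ> T' = id"
    using homography_inverse[OF N.homography_S] .
  have TS: "T (S x) = x" "T' (S' x) = x" for x
    using T(2) T'(2) by (metis comp_apply id_apply)+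
  have "algebraic_map M N f"
    unfolding algebraic_map_def
    using regular_homography[OF homography_comp[OF N.homography_S T(1)]] f(1)
    by (auto simp: f_eq N.crd_S M.crd_S TS intro!: exI[of _ "S' \<circ> T"])
  moreover have "algebraic_map N M (inv_into (pts M) f)"
    unfolding algebraic_map_def
    using regular_homography[OF homography_comp[OF M.homography_S T'(1)]]
    by (auto simp: inv N.crd_S M.crd_S TS intro!: exI[of _ "S \<circ> T'"])
  moreover have "f (neu M) = neu N"
    by (simp add: f_eq M.neu_pts M.u_neu N.neu_point)
  moreover have "map_option (image_mset f) (mul M p q) = mul N (f p) (f q)"
    if "p \<in> pts M" "q \<in> pts M" for p q
    using that by (cases "u p"; cases "u q") (simp_all add: M.mul_point N.mul_point f_eq)
  ultimately show ?thesis
    using bij unfolding nv_iso_def by blast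
qed

text \<open>When \<open>S\<close> commutes with sign change and squaring, as the identity and inversion do, the orbits of \<open>h\<close>
are described by squares in either coordinate.\<close>
locale square_chart = additive_chart +
  assumes S_neg: "S (cp1_neg x) = cp1_neg (S x)"
    and S_square: "cp1_square (S x) = S (cp1_square x)"
begin

lemma crd_h: "p \<in> pts M \<Longrightarrow> crd M (h p) = cp1_neg (crd M p)"
  by (simp add: crd_S h_pts u_h S_neg)

lemma aut_group: "aut_group M {id, h}"
proof -
  have "additive_chart M h u S" ..
  moreover note additive_chart_neg
  ultimately have "nv_iso id M M" "nv_iso h M M"
    by (auto intro: nv_iso_charts simp: h_pts u_h)
  moreover have "\<exists>p\<in>pts M. h p \<noteq> p"
    using h_moves_point point_pts by blast
  moreover have "h \<circ> h = id" by (auto simp: h_h)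
  ultimately show ?thesis
    unfolding aut_group_def by (auto simp: eq_commute)
qed

lemma coset_word:
  assumes "p \<in> pts M" "q \<in> pts M"
  shows "coset_word M {id, h} p q = map_option (image_mset point) (sum_diff (u p) (u q))"
proof -
  have "mset_set {id, h} = {#id, h#}" using h_neq_id by (subst mset_set.insert) auto
  thus ?thesis
    unfolding coset_word_def using assms
    by (cases "u p"; cases "u q") (simp_all add: mbind_pair mul_point h_pts u_h)
qed

lemma bij_crd: "bij_betw (crd M) (pts M) UNIV"
  using algebraic by (simp add: algebraic_nvmonoid_def)

lemma orbit_map_square: "orbit_map M {id, h} (\<lambda>p. cp1_square (crd M p))"
proof -
  have "regular_cp1 cp1_square"
    unfolding regular_cp1_def
  proof (rule exI[of _ 2], rule exI[of _ "[:0, 0, 1:]"], rule exI[of _ "[:1:]"], intro conjI allI)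
    fix x show "\<not> (bform 2 [:0, 0, 1:] x = 0 \<and> bform 2 [:1:] x = 0)"
      "cp1_square x = ratio (bform 2 [:0, 0, 1:] x) (bform 2 [:1:] x)"
      by (cases x; simp add: bform_def eval_nat_numeral ratio_def)+
  qed simp_all
  moreover have "(\<lambda>p. cp1_square (crd M p)) ` pts M = UNIV"
    using bij_crd cp1_square_surj by (auto simp: bij_betw_def image_iff) (metis UNIV_I image_iff)
  moreover have "cp1_square (crd M p) = cp1_square (crd M q) \<longleftrightarrow> (\<exists>g\<in>{id, h}. q = g p)"
    if "p \<in> pts M" "q \<in> pts M" for p q
    using that bij_crd h_pts unfolding cp1_square_eq_iff crd_h[OF that(1), symmetric]
    by (auto simp: bij_betw_def inj_on_eq_iff)
  moreover have "\<exists>g. regular_cp1 g \<and> (\<forall>p\<in>pts M. cp1_square (crd M p) = g (crd M p))"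
    using \<open>regular_cp1 cp1_square\<close> by (intro exI[of _ cp1_square]) simp
  ultimately show ?thesis
    unfolding orbit_map_def by blast
qed

lemma orbit_map_unique:
  assumes "orbit_map M {id, h} \<pi>"
  obtains a b c d where "a * d \<noteq> b * c"
    "\<And>p. p \<in> pts M \<Longrightarrow> \<pi> p = moebius a b c d (cp1_square (u p))"
proof -
  obtain g where g: "regular_cp1 g" "\<And>p. p \<in> pts M \<Longrightarrow> \<pi> p = g (crd M p)"
    using assms unfolding orbit_map_def by (elim conjE exE) simp
  have fibre: "\<pi> p = \<pi> q \<longleftrightarrow> q = p \<or> q = h p" if "p \<in> pts M" "q \<in> pts M" for p q
    using assms that unfolding orbit_map_def by simp
  have g_fibre: "g x = g y \<longleftrightarrow> y = x \<or> y = cp1_neg x" for x y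
  proof -
    have "x \<in> crd M ` pts M" "y \<in> crd M ` pts M"
      using bij_crd by (simp_all add: bij_betw_def)
    then obtain p q where pq: "p \<in> pts M" "q \<in> pts M" "x = crd M p" "y = crd M q"
      by blast
    have "g x = g y \<longleftrightarrow> q = p \<or> q = h p"
      using fibre[OF pq(1,2)] g(2) pq by auto
    also have "\<dots> \<longleftrightarrow> crd M q = crd M p \<or> crd M q = crd M (h p)"
      using bij_crd pq h_pts by (auto simp: bij_betw_def inj_on_eq_iff)
    finally show ?thesis by (simp add: crd_h pq)
  qed
  obtain T where T: "homography T" "g = T \<circ> cp1_square"
    by (rule regular_even_quotient[OF g(1) g_fibre])
  obtain a b c d where det: "a * d \<noteq> b * c" and TS: "T \<circ> S = moebius a b c d"
    using homography_comp[OF T(1) homography_S] by (rule homographyE)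
  have "\<pi> p = moebius a b c d (cp1_square (u p))" if "p \<in> pts M" for p
    unfolding TS[symmetric] using that by (simp add: g(2) T(2) crd_S S_square)
  with det show ?thesis by (rule that)
qed

text \<open>An orbit map is onto, so the coset words leave no choice for the multiplication.\<close>
lemma coset_monoid_square_monoid:
  assumes "orbit_map M {id, h} \<pi>" and det: "a * d \<noteq> b * c"
    and \<pi>: "\<And>p. p \<in> pts M \<Longrightarrow> \<pi> p = moebius a b c d (cp1_square (u p))"
  shows "coset_monoid M {id, h} \<pi> N \<longleftrightarrow> N = square_monoid a b c d"
proof
  have mul: "form_op 2 2 2 (square_poly a b c d) (\<pi> p) (\<pi> q) =
      map_option (image_mset \<pi>) (coset_word M {id, h} p q)" if "p \<in> pts M" "q \<in> pts M" for p q
  proof -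
    have "\<pi> \<circ> point = moebius a b c d \<circ> cp1_square" by (auto simp: \<pi>)
    thus ?thesis
      using that by (simp add: \<pi> coset_word form_op_square_poly[OF det] option.map_comp comp_def
          multiset.map_comp)
  qed
  show "coset_monoid M {id, h} \<pi> N" if N: "N = square_monoid a b c d"
    unfolding coset_monoid_def N using assms(1) algebraic aut_group mul
    by (simp add: square_monoid_def \<pi> neu_pts u_neu)
  assume N: "coset_monoid M {id, h} \<pi> N"
  have "mul N x y = form_op 2 2 2 (square_poly a b c d) x y" for x y
  proof -
    obtain p q where "p \<in> pts M" "q \<in> pts M" "x = \<pi> p" "y = \<pi> q"
      using assms(1) unfolding orbit_map_def by (metis UNIV_I image_iff)
    thus ?thesis using N mul by (simp add: coset_monoid_def)
  qed
  thus "N = square_monoid a b c d"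
    using N by (intro nvmonoid.equality)
      (auto simp: coset_monoid_def square_monoid_def fun_eq_iff \<pi> neu_pts u_neu)
qed

end

text \<open>The isomorphism \<open>\<Phi>\<close> matches points with the same additive coordinate. If the orbit maps are \<open>S1\<close> and
\<open>S2\<close> after squaring, the isomorphism of quotients that it induces is \<open>S2 \<circ> inv S1\<close>.\<close>
lemma coset_isomorphic_charts:
  assumes M: "square_chart M h u S" and M': "square_chart M' h' u' S'"
    and N: "coset_monoid M {id, h} \<pi> N" and N': "coset_monoid M' {id, h'} \<pi>' N'"
  shows "coset_isomorphic M {id, h} \<pi> N M' {id, h'} \<pi>' N'"
proof -
  interpret M: square_chart M h u S by fact
  interpret M': square_chart M' h' u' S' by fact
  have o: "orbit_map M {id, h} \<pi>" "orbit_map M' {id, h'} \<pi>'"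
    using N N' by (simp_all add: coset_monoid_def)
  obtain a b c d where T: "a * d \<noteq> b * c"
    "\<And>p. p \<in> pts M \<Longrightarrow> \<pi> p = moebius a b c d (cp1_square (u p))"
    using o(1) by (rule M.orbit_map_unique) blast
  obtain a' b' c' d' where T': "a' * d' \<noteq> b' * c'"
    "\<And>p. p \<in> pts M' \<Longrightarrow> \<pi>' p = moebius a' b' c' d' (cp1_square (u' p))"
    using o(2) by (rule M'.orbit_map_unique) blast
  define S1 where "S1 = moebius a b c d"
  define S2 where "S2 = moebius a' b' c' d'"
  have N_eq: "N = square_monoid a b c d" "N' = square_monoid a' b' c' d'"
    using M.coset_monoid_square_monoid[OF o(1) T] M'.coset_monoid_square_monoid[OF o(2) T'] N N'
    by auto
  have S1: "homography S1" and S2: "homography S2"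
    using T(1) T'(1) unfolding S1_def S2_def homography_def by blast+
  define \<Phi> where "\<Phi> = M'.point \<circ> u"
  define \<phi> where "\<phi> = S2 \<circ> inv S1"
  have \<phi>: "\<phi> (S1 x) = S2 x" for x
    using bij_homography[OF S1] by (simp add: \<phi>_def bij_is_inj)
  have hom: "homography \<phi>" unfolding \<phi>_def by (intro homography_comp homography_inv S1 S2)
  have \<Phi>_iso: "nv_iso \<Phi> M M'"
    using M.additive_chart_axioms M'.additive_chart_axioms
    by (rule nv_iso_charts) (simp_all add: \<Phi>_def)
  have "nv_iso \<phi> N N'"
  proof -
    have "map_option (image_mset \<phi>) (mul N x y) = mul N' (\<phi> x) (\<phi> y)" for x y
    proof -
      obtain v w where xy: "x = S1 (cp1_square v)" "y = S1 (cp1_square w)"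
        using bij_homography[OF S1] cp1_square_surj by (metis bij_is_surj surj_def)
      have "mul N x y = map_option (image_mset (S1 \<circ> cp1_square)) (sum_diff v w)"
        unfolding xy S1_def by (simp add: N_eq square_monoid_def form_op_square_poly[OF T(1)])
      moreover have "mul N' (\<phi> x) (\<phi> y) = map_option (image_mset (S2 \<circ> cp1_square)) (sum_diff v w)"
        unfolding xy \<phi> unfolding S2_def
        by (simp add: N_eq square_monoid_def form_op_square_poly[OF T'(1)])
      moreover have "\<phi> \<circ> (S1 \<circ> cp1_square) = S2 \<circ> cp1_square" by (auto simp: \<phi>)
      ultimately show ?thesis
        by (simp only: option.map_comp comp_def multiset.map_comp)
    qed
    moreover have "\<phi> (neu N) = neu N'"
      using \<phi>[of "Fin 0"] by (simp add: N_eq square_monoid_def S1_def S2_def)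
    ultimately show ?thesis
      unfolding nv_iso_def algebraic_map_def
      using bij_homography[OF hom] regular_homography[OF hom]
        regular_homography[OF homography_inv[OF hom]]
      by (auto simp: N_eq square_monoid_def)
  qed
  moreover have "\<phi> (\<pi> p) = \<pi>' (\<Phi> p)" if "p \<in> pts M" for p
    using that \<phi> by (simp add: T T' \<Phi>_def S1_def S2_def)
  moreover have "map_option (image_mset \<Phi>) (coset_word M {id, h} p q) =
      coset_word M' {id, h'} (\<Phi> p) (\<Phi> q)" if "p \<in> pts M" "q \<in> pts M" for p q
  proof -
    have "\<Phi> \<circ> M.point = M'.point" by (auto simp: \<Phi>_def)
    thus ?thesis
      using that by (simp add: M.coset_word M'.coset_word \<Phi>_def option.map_comp comp_def
          multiset.map_comp)
  qed
  ultimately show ?thesis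
    unfolding coset_isomorphic_def using N N' \<Phi>_iso by blast
qed

section \<open>The additive monoid and the cuspidal cubic\<close>

lemma additive_monoid_chart: "square_chart additive_monoid cp1_neg id id"
  by unfold_locales
    (auto simp: additive_monoid_def homography_id option.map_id0 multiset.map_id0)

lemma pn_2: "pn 2 = square_poly 1 0 0 1"
proof (rule pn_eqI)
  fix u v w :: complex
  show "eval3 (square_poly 1 0 0 1) (w ^ 2) (u ^ 2) (v ^ 2) =
      (\<Prod>r = 1..2. \<Prod>s = 1..2.
         w + exp (2 * pi * \<i> / (2::nat)) ^ r * u + exp (2 * pi * \<i> / (2::nat)) ^ s * v)"
    unfolding exp_root_2 prod_1_to
    apply (simp add: square_poly_def Let_def tensor_def map_poly_pCons eval3_def)
    by algebra
qed simp

lemma Mn_2: "Mn 2 = square_monoid 1 0 0 1"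
  by (simp add: Mn_def pn_2 scale_xy_1 cp1_monoid_def square_monoid_def moebius_id)

lemma coset_monoid_Mn_2: "coset_monoid additive_monoid {id, cp1_neg} cp1_square (Mn 2)"
proof -
  interpret square_chart additive_monoid cp1_neg id id by (rule additive_monoid_chart)
  have "orbit_map additive_monoid {id, cp1_neg} cp1_square"
    using orbit_map_square by (simp add: additive_monoid_def)
  moreover have "cp1_square p = moebius 1 0 0 1 (cp1_square (id p))" for p
    by (simp add: moebius_id)
  ultimately show ?thesis
    by (simp add: Mn_2 coset_monoid_square_monoid[of cp1_square 1 1 0 0])
qed

lemma on_cusp_slope: "on_cusp \<alpha> P \<Longrightarrow> cusp_point \<alpha> (slope \<alpha> P) = P"
proof transfer
  fix \<alpha> :: complex and P
  assume nz: "proj_rel P P" and on: "case P of (\<zeta>, \<eta>, \<tau>) \<Rightarrow> \<eta>\<^sup>2 * \<tau> = (\<zeta> - \<alpha> * \<tau>) ^ 3"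
  obtain \<zeta> \<eta> \<tau> where P: "P = (\<zeta>, \<eta>, \<tau>)" by (cases P) auto
  let ?point = "\<lambda>m. (\<alpha> * den m ^ 3 + num m ^ 2 * den m, num m ^ 3, den m ^ 3)"
  define m where "m = (if \<eta> = 0 then Fin 0 else ratio \<eta> (\<zeta> - \<alpha> * \<tau>))"
  have eq: "\<eta>\<^sup>2 * \<tau> = (\<zeta> - \<alpha> * \<tau>) ^ 3" using on P by simp
  have nz': "\<zeta> \<noteq> 0 \<or> \<eta> \<noteq> 0 \<or> \<tau> \<noteq> 0"
    using nz unfolding P by (auto simp: proj_rel_iff zero_prod_def)
  consider "\<eta> = 0" | "\<eta> \<noteq> 0" "\<zeta> = \<alpha> * \<tau>" | "\<eta> \<noteq> 0" "\<zeta> \<noteq> \<alpha> * \<tau>" by blast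
  hence "\<exists>k. k \<noteq> 0 \<and> P = (k * (\<alpha> * den m ^ 3 + num m ^ 2 * den m), k * num m ^ 3, k * den m ^ 3)"
  proof cases
    case 1
    hence "\<zeta> = \<alpha> * \<tau>" using eq by simp
    with 1 nz' show ?thesis unfolding P m_def by (intro exI[of _ \<tau>]) auto
  next
    case 2
    hence "\<tau> = 0" using eq by simp
    with 2 show ?thesis unfolding P m_def by (intro exI[of _ \<eta>]) (simp add: ratio_def)
  next
    case 3
    define \<delta> where "\<delta> = \<zeta> - \<alpha> * \<tau>"
    have \<delta>: "\<delta> \<noteq> 0" "\<zeta> = \<alpha> * \<tau> + \<delta>" using 3 by (simp_all add: \<delta>_def)
    have cube: "\<eta>\<^sup>2 * \<tau> = \<delta> ^ 3" using eq by (simp add: \<delta>_def)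
    have "\<tau> * (\<eta> / \<delta>)\<^sup>2 = \<delta>" "\<tau> * (\<eta> / \<delta>) ^ 3 = \<eta>"
      using \<delta>(1) cube by (simp_all add: field_simps power2_eq_square power3_eq_cube)
    moreover have "\<tau> \<noteq> 0" using \<delta> cube by auto
    ultimately show ?thesis
      using 3 \<delta> unfolding P m_def by (intro exI[of _ \<tau>]) (simp add: ratio_def distrib_left)
  qed
  moreover have "?point m \<noteq> 0" by (cases m) (auto simp: zero_prod_def)
  moreover have "(case P of (\<zeta>, \<eta>, \<tau>) \<Rightarrow> if \<eta> = 0 then Fin 0 else ratio \<eta> (\<zeta> - \<alpha> * \<tau>)) = m"
    by (simp add: P m_def)
  ultimately show "proj_rel
     (?point (case P of (\<zeta>, \<eta>, \<tau>) \<Rightarrow> if \<eta> = 0 then Fin 0 else ratio \<eta> (\<zeta> - \<alpha> * \<tau>))) P"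
    by (simp only: proj_rel_iff) blast
qed

lemma cusp_inv_cusp_inv: "cusp_inv (cusp_inv P) = P"
  by transfer (auto simp: proj_rel_iff zero_prod_def intro!: exI[of _ 1])

lemma cusp_inv_cusp_point: "cusp_inv (cusp_point \<alpha> m) = cusp_point \<alpha> (cp1_neg m)"
  by transfer (case_tac m; auto simp: proj_rel_iff zero_prod_def intro!: exI[of _ 1] exI[of _ "- 1"])

definition cp1_inverse :: "cp1 \<Rightarrow> cp1" where "cp1_inverse = moebius 0 1 1 0"

lemma cp1_inverse_simps [simp]:
  "cp1_inverse Inf = Fin 0"
  "cp1_inverse (Fin z) = (if z = 0 then Inf else Fin (inverse z))"
  by (simp_all add: cp1_inverse_def moebius_def ratio_def field_simps)

lemma cp1_inverse_inverse [simp]: "cp1_inverse (cp1_inverse x) = x"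
  by (cases x) auto

lemma slope_add_inverse:
  "map_option (\<lambda>m. {#cp1_inverse m#}) (slope_add m1 m2) =
     mul additive_monoid (cp1_inverse m1) (cp1_inverse m2)"
  by (cases m1; cases m2) (auto simp: slope_add_def ratio_def field_simps)

text \<open>The formula \<open>1 / (m\<^sub>1 \<oplus> m\<^sub>2) = 1 / m\<^sub>1 + 1 / m\<^sub>2\<close> is what makes the inverse slope additive; the cusp
goes to the point \<open>\<infinity>\<close> of the additive monoid.\<close>
lemma cusp_monoid_chart:
  "square_chart (cusp_monoid \<alpha>) cusp_inv (\<lambda>P. cp1_inverse (slope \<alpha> P)) cp1_inverse"
proof unfold_locales
  show "bij_betw (\<lambda>P. cp1_inverse (slope \<alpha> P)) (pts (cusp_monoid \<alpha>)) UNIV"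
    by (rule bij_betwI[of _ _ _ "\<lambda>x. cusp_point \<alpha> (cp1_inverse x)"])
      (auto simp: cusp_monoid_def on_cusp_slope on_cusp_cusp_point slope_cusp_point)
  show "homography cp1_inverse" unfolding homography_def cp1_inverse_def
    by (rule exI[of _ 0], rule exI[of _ 1], rule exI[of _ 1], rule exI[of _ 0]) simp
  fix P Q m
  assume P: "P \<in> pts (cusp_monoid \<alpha>)"
  hence P_eq: "P = cusp_point \<alpha> (slope \<alpha> P)" by (simp add: cusp_monoid_def on_cusp_slope)
  have inv: "cusp_inv P = cusp_point \<alpha> (cp1_neg (slope \<alpha> P))"
    by (subst P_eq) (rule cusp_inv_cusp_point)
  thus "cusp_inv P \<in> pts (cusp_monoid \<alpha>)"
    by (simp add: cusp_monoid_def on_cusp_cusp_point)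
  show "cp1_inverse (slope \<alpha> (cusp_inv P)) = cp1_neg (cp1_inverse (slope \<alpha> P))"
    by (cases "slope \<alpha> P") (simp_all add: inv slope_cusp_point)
  show "map_option (image_mset (\<lambda>P. cp1_inverse (slope \<alpha> P))) (mul (cusp_monoid \<alpha>) P Q) =
    mul additive_monoid (cp1_inverse (slope \<alpha> P)) (cp1_inverse (slope \<alpha> Q))"
    unfolding slope_add_inverse[symmetric]
    by (simp add: cusp_monoid_def option.map_comp comp_def slope_cusp_point)
  show "set_mset m \<subseteq> pts (cusp_monoid \<alpha>)" if "mul (cusp_monoid \<alpha>) P Q = Some m"
    using that by (auto simp: cusp_monoid_def on_cusp_cusp_point)
next
  fix x
  show "cp1_inverse (cp1_neg x) = cp1_neg (cp1_inverse x)"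
       "cp1_square (cp1_inverse x) = cp1_inverse (cp1_square x)"
    by (cases x; simp add: power_inverse)+
qed (simp_all add: cusp_monoid_def slope_cusp_point on_cusp_cusp_point cusp_inv_cusp_inv)



section \<open>The coset monoid of the cuspidal cubic and the limits of the groups\<close>

theorem theorem7:
  fixes \<alpha> :: complex
  shows
    "(algebraic_nvmonoid 1 (cusp_monoid \<alpha>) \<and>
      aut_group (cusp_monoid \<alpha>) {id, cusp_inv} \<and> card {id, cusp_inv} = 2 \<and>
      (\<exists>\<pi>. orbit_map (cusp_monoid \<alpha>) {id, cusp_inv} \<pi>) \<and>
      (\<forall>\<pi>. orbit_map (cusp_monoid \<alpha>) {id, cusp_inv} \<pi> \<longrightarrow>
         (\<exists>!N. coset_monoid (cusp_monoid \<alpha>) {id, cusp_inv} \<pi> N)) \<and>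
      (\<forall>\<pi> N. coset_monoid (cusp_monoid \<alpha>) {id, cusp_inv} \<pi> N \<longrightarrow>
         algebraic_nvmonoid 2 N \<and>
         coset_isomorphic (cusp_monoid \<alpha>) {id, cusp_inv} \<pi> N
                          additive_monoid {id, cp1_neg} cp1_square (Mn 2)) \<and>
      (\<forall>\<beta> \<pi> \<pi>' N N'.
         coset_monoid (cusp_monoid \<alpha>) {id, cusp_inv} \<pi> N \<longrightarrow>
         coset_monoid (cusp_monoid \<beta>) {id, cusp_inv} \<pi>' N' \<longrightarrow>
         coset_isomorphic (cusp_monoid \<alpha>) {id, cusp_inv} \<pi> N
                          (cusp_monoid \<beta>) {id, cusp_inv} \<pi>' N')) \<and>
     (coeffwise_limit G3_poly (G3_poly 0) \<and> cp1_monoid 3 (G3_poly 0) = Mn 3) \<and>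
     (coeffwise_limit G4_poly (G4_poly 0) \<and> cp1_monoid 4 (G4_poly 0) = Mn 4) \<and>
     (coeffwise_limit G6_poly (G6_poly 0) \<and> cp1_monoid 6 (G6_poly 0) = Mn 6)"
proof (intro conjI)
  interpret cusp: square_chart "cusp_monoid \<alpha>" cusp_inv "\<lambda>P. cp1_inverse (slope \<alpha> P)" cp1_inverse
    by (rule cusp_monoid_chart)
  show "algebraic_nvmonoid 1 (cusp_monoid \<alpha>)" by (rule cusp.algebraic)
  show "aut_group (cusp_monoid \<alpha>) {id, cusp_inv}" by (rule cusp.aut_group)
  show "card {id, cusp_inv} = 2" using cusp.h_neq_id by (simp add: eq_commute)
  show "\<exists>\<pi>. orbit_map (cusp_monoid \<alpha>) {id, cusp_inv} \<pi>"
    using cusp.orbit_map_square by blast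
  show "\<forall>\<pi>. orbit_map (cusp_monoid \<alpha>) {id, cusp_inv} \<pi> \<longrightarrow>
         (\<exists>!N. coset_monoid (cusp_monoid \<alpha>) {id, cusp_inv} \<pi> N)"
    using cusp.orbit_map_unique cusp.coset_monoid_square_monoid by metis
  show "\<forall>\<pi> N. coset_monoid (cusp_monoid \<alpha>) {id, cusp_inv} \<pi> N \<longrightarrow>
         algebraic_nvmonoid 2 N \<and>
         coset_isomorphic (cusp_monoid \<alpha>) {id, cusp_inv} \<pi> N
                          additive_monoid {id, cp1_neg} cp1_square (Mn 2)"
  proof (intro allI impI conjI)
    fix \<pi> N assume N: "coset_monoid (cusp_monoid \<alpha>) {id, cusp_inv} \<pi> N"
    hence o: "orbit_map (cusp_monoid \<alpha>) {id, cusp_inv} \<pi>" by (simp add: coset_monoid_def)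
    obtain a b c d where T: "a * d \<noteq> b * c"
      "\<And>P. P \<in> pts (cusp_monoid \<alpha>) \<Longrightarrow>
        \<pi> P = moebius a b c d (cp1_square (cp1_inverse (slope \<alpha> P)))"
      using o by (rule cusp.orbit_map_unique) blast
    have "N = square_monoid a b c d"
      using cusp.coset_monoid_square_monoid[OF o T] N by blast
    thus "algebraic_nvmonoid 2 N" using algebraic_square_monoid[OF T(1)] by simp
    show "coset_isomorphic (cusp_monoid \<alpha>) {id, cusp_inv} \<pi> N
        additive_monoid {id, cp1_neg} cp1_square (Mn 2)"
      by (rule coset_isomorphic_charts[OF cusp_monoid_chart additive_monoid_chart N coset_monoid_Mn_2])
  qed
  show "\<forall>\<beta> \<pi> \<pi>' N N'.
         coset_monoid (cusp_monoid \<alpha>) {id, cusp_inv} \<pi> N \<longrightarrow>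
         coset_monoid (cusp_monoid \<beta>) {id, cusp_inv} \<pi>' N' \<longrightarrow>
         coset_isomorphic (cusp_monoid \<alpha>) {id, cusp_inv} \<pi> N
                          (cusp_monoid \<beta>) {id, cusp_inv} \<pi>' N'"
    using coset_isomorphic_charts[OF cusp_monoid_chart cusp_monoid_chart] by blast
qed (rule coeffwise_limits limit_monoids)+

end
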